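(* For all sufficiently large $n$, the largest size of a $2$-dimensional hypercut over $\mathbb{F}_2$ on vertex set $[n]$ is $\binom{n}{3}-\left(\frac34n^2-\frac72n+4\right)$ if $n$ is even and $\binom{n}{3}-\left(\frac34n^2-4n+\frac{25}{4}\right)$ if $n$ is odd.
   Context: Over $\mathbb{F}_2$, consider the boundary matrix $\partial_2$ whose columns are indexed by the triples in $\binom{[n]}{3}$ and rows by pairs in $\binom{[n]}{2}$, the column of $\{a,b,c\}$ being the indicator vector of $\{ab,bc,ac\}$. A set of triples is acyclic if its columns are linearly independent over $\mathbb{F}_2$; a $2$-hypertree is a maximal acyclic set of triples. A $2$-dimensional hypercut is an inclusion-minimal set of triples meeting every $2$-hypertree (equivalently, an inclusion-minimal nonempty set of triples of the form $\{\sigma:\ |\partial\sigma\cap A|\text{ odd}\}$ for some set $A$ of pairs). Its size is the number of triples in it. *)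

theory Defs
  imports Complex_Main "HOL-Library.Z2" "HOL-Library.Function_Algebras"
begin

definition k_subsets :: "nat \<Rightarrow> nat \<Rightarrow> nat set set" where
  "k_subsets n k = {s. s \<subseteq> {1..n} \<and> card s = k}"

abbreviation pairs :: "nat \<Rightarrow> nat set set" where
  "pairs n \<equiv> k_subsets n 2"

abbreviation triples :: "nat \<Rightarrow> nat set set" where
  "triples n \<equiv> k_subsets n 3"

text \<open>
  \<open>bit\<close> is the field with two elements. Vectors indexed by \<open>pairs n\<close> are represented as
  functions \<open>nat set \<Rightarrow> bit\<close> that vanish off \<open>pairs n\<close>.
\<close>

definition scaleF2 :: "bit \<Rightarrow> (nat set \<Rightarrow> bit) \<Rightarrow> nat set \<Rightarrow> bit" where
  "scaleF2 c v = (\<lambda>p. c * v p)"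

global_interpretation F2: vector_space scaleF2
proof
  fix a b :: bit and x y :: "nat set \<Rightarrow> bit"
  show "scaleF2 a (x + y) = scaleF2 a x + scaleF2 a y"
    by (rule ext) (simp only: scaleF2_def plus_fun_apply distrib_left)
  show "scaleF2 (a + b) x = scaleF2 a x + scaleF2 b x"
    by (rule ext) (simp only: scaleF2_def plus_fun_apply distrib_right)
  show "scaleF2 a (scaleF2 b x) = scaleF2 (a * b) x"
    by (rule ext) (simp only: scaleF2_def mult.assoc)
  show "scaleF2 1 x = x"
    by (rule ext) (simp only: scaleF2_def mult_1_left)
qed

definition boundary_col :: "nat \<Rightarrow> nat set \<Rightarrow> nat set \<Rightarrow> bit" where
  "boundary_col n \<sigma> = (\<lambda>p. if p \<in> pairs n \<and> p \<subseteq> \<sigma> then 1 else 0)"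

lemma boundary_col_inj: "inj_on (boundary_col n) (triples n)"
proof (rule inj_onI)
  have sub: "\<sigma> \<subseteq> \<tau>"
    if "\<sigma> \<in> triples n" and eq: "boundary_col n \<sigma> = boundary_col n \<tau>" for \<sigma> \<tau>
  proof
    fix x assume "x \<in> \<sigma>"
    have \<sigma>: "\<sigma> \<subseteq> {1..n}" "card \<sigma> = 3"
      using that(1) by (simp_all add: k_subsets_def)
    then have "finite \<sigma>"
      using finite_subset by blast
    then have "card (\<sigma> - {x}) = 2"
      using \<sigma>(2) \<open>x \<in> \<sigma>\<close> by simp
    then have "\<sigma> - {x} \<noteq> {}"
      by (metis card.empty zero_neq_numeral)
    then obtain y where y: "y \<in> \<sigma>" "y \<noteq> x"
      by blast
    have "{x, y} \<subseteq> \<sigma>"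
      using \<open>x \<in> \<sigma>\<close> y(1) by simp
    moreover have "{x, y} \<in> pairs n"
      using \<open>x \<in> \<sigma>\<close> y \<sigma>(1) by (simp add: k_subsets_def subset_iff)
    ultimately have "boundary_col n \<sigma> {x, y} = 1"
      by (simp add: boundary_col_def)
    then have "boundary_col n \<tau> {x, y} \<noteq> 0"
      using eq by simp
    then have "{x, y} \<subseteq> \<tau>"
      unfolding boundary_col_def by meson
    then show "x \<in> \<tau>"
      by simp
  qed
  fix \<sigma> \<tau>
  assume "\<sigma> \<in> triples n" "\<tau> \<in> triples n" "boundary_col n \<sigma> = boundary_col n \<tau>"
  then show "\<sigma> = \<tau>"
    using sub[of \<sigma> \<tau>] sub[of \<tau> \<sigma>] by (intro equalityI) metis+
qed

text \<open>
  By \<open>boundary_col_inj\<close>, independence of the set of columns is the same as independence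
  of the family of columns.
\<close>

definition acyclic_triples :: "nat \<Rightarrow> nat set set \<Rightarrow> bool" where
  "acyclic_triples n F \<longleftrightarrow> F \<subseteq> triples n \<and> F2.independent (boundary_col n ` F)"

definition hypertree :: "nat \<Rightarrow> nat set set \<Rightarrow> bool" where
  "hypertree n T \<longleftrightarrow> acyclic_triples n T \<and> (\<forall>F. acyclic_triples n F \<longrightarrow> T \<subseteq> F \<longrightarrow> F = T)"

definition meets_all_hypertrees :: "nat \<Rightarrow> nat set set \<Rightarrow> bool" where
  "meets_all_hypertrees n C \<longleftrightarrow> (\<forall>T. hypertree n T \<longrightarrow> C \<inter> T \<noteq> {})"

definition hypercut :: "nat \<Rightarrow> nat set set \<Rightarrow> bool" where
  "hypercut n C \<longleftrightarrow>
     C \<subseteq> triples n \<and> meets_all_hypertrees n C \<and> (\<forall>D. D \<subset> C \<longrightarrow> \<not> meets_all_hypertrees n D)"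

end

theory Submission
  imports Defs
begin

text \<open>
  By linear duality, hypercuts are the inclusion-minimal nonempty sets of triples that meet some
  graph in an odd number of edges. The complement of a hypercut therefore is the set of odd triples
  of a graph \<open>E\<close>, determined up to switching, and we take \<open>E\<close> with as few edges as possible.
  Switching at a vertex shows that all degrees are less than \<open>n/2\<close>; minimality of the hypercut,
  tested against complete bipartite graphs, shows that \<open>E\<close> has at most two components and no two
  nonadjacent vertices with the same neighbours. The number of odd triples is
  \<open>(\<Sum>x. d\<^sub>x (n/2 - d\<^sub>x)) + 4 T\<close> with \<open>T\<close> the number of triangles.
  If it is at most \<open>3n\<^sup>2/4\<close>, comparing with the number of edges forces one hub \<open>c\<close> of degree close to
  \<open>n/2\<close> while all other degrees are small. Then only \<open>E - c\<close> matters: it has at most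
  two isolated vertices, so it is close to a perfect matching, and the count becomes a
  concave quadratic in the number of its edges. The optimum is a spider with legs of length two and
  one isolated vertex.
\<close>

section \<open>Hypercuts as minimal coboundaries\<close>

text \<open>The nested inequations are addition over the two-element field. For a loopless symmetric
  \<open>E\<close> the partial application \<open>odd_tri E v\<close> is again a graph:
  \<open>E\<close> switched so that \<open>v\<close> becomes isolated.\<close>

definition odd_tri :: "('a \<Rightarrow> 'a \<Rightarrow> bool) \<Rightarrow> 'a \<Rightarrow> 'a \<Rightarrow> 'a \<Rightarrow> bool" where
  "odd_tri E x y z \<longleftrightarrow> ((E x y \<noteq> E y z) \<noteq> E x z)"

definition coboundary :: "nat \<Rightarrow> (nat \<Rightarrow> nat \<Rightarrow> bool) \<Rightarrow> nat set set" where
  "coboundary n E = {\<sigma>. \<exists>x\<in>{1..n}. \<exists>y\<in>{1..n}. \<exists>z\<in>{1..n}.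
     \<sigma> = {x, y, z} \<and> x \<noteq> y \<and> y \<noteq> z \<and> x \<noteq> z \<and> odd_tri E x y z}"

lemma triplesE:
  assumes "\<sigma> \<in> triples n"
  obtains x y z where "x \<in> {1..n}" "y \<in> {1..n}" "z \<in> {1..n}" "\<sigma> = {x, y, z}"
    "x \<noteq> y" "y \<noteq> z" "x \<noteq> z"
proof -
  have "card \<sigma> = 3" "\<sigma> \<subseteq> {1..n}"
    using assms by (auto simp: k_subsets_def)
  then show ?thesis
    using that by (auto simp: card_3_iff)
qed

lemma triplesI:
  assumes "x \<in> {1..n}" "y \<in> {1..n}" "z \<in> {1..n}" "x \<noteq> y" "y \<noteq> z" "x \<noteq> z"
  shows "{x, y, z} \<in> triples n"
  using assms by (auto simp: k_subsets_def)

lemma coboundary_subset: "coboundary n E \<subseteq> triples n"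
  by (auto simp: coboundary_def k_subsets_def)

lemma mem_coboundary_iff:
  assumes "symp E" "x \<in> {1..n}" "y \<in> {1..n}" "z \<in> {1..n}" "x \<noteq> y" "y \<noteq> z" "x \<noteq> z"
  shows "{x, y, z} \<in> coboundary n E \<longleftrightarrow> odd_tri E x y z"
proof
  have sym: "E a b = E b a" for a b
    using \<open>symp E\<close> by (metis sympD)
  assume "{x, y, z} \<in> coboundary n E"
  then obtain a b c where *: "{x, y, z} = {a, b, c}" "a \<noteq> b" "b \<noteq> c" "a \<noteq> c" "odd_tri E a b c"
    unfolding coboundary_def by auto
  have "(x = a \<and> y = b \<and> z = c) \<or> (x = a \<and> y = c \<and> z = b) \<or> (x = b \<and> y = a \<and> z = c) \<or>
    (x = b \<and> y = c \<and> z = a) \<or> (x = c \<and> y = a \<and> z = b) \<or> (x = c \<and> y = b \<and> z = a)"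
    using *(1-4) assms(5-7) by (smt (verit) insert_iff singletonD)
  then show "odd_tri E x y z"
    using *(5) sym[of a b] sym[of b c] sym[of a c] unfolding odd_tri_def by (elim disjE) auto
qed (use assms in \<open>unfold coboundary_def, blast\<close>)

section \<open>Linear functionals on the columns and the graphs they define\<close>

definition unit_vec :: "nat set \<Rightarrow> nat set \<Rightarrow> bit" where
  "unit_vec p = (\<lambda>q. of_bool (q = p))"

lemma boundary_col_triple:
  assumes "x \<in> {1..n}" "y \<in> {1..n}" "z \<in> {1..n}" "x \<noteq> y" "y \<noteq> z" "x \<noteq> z"
  shows "boundary_col n {x, y, z} = unit_vec {x, y} + unit_vec {y, z} + unit_vec {x, z}"
proof
  fix q
  have eq: "q \<in> pairs n \<and> q \<subseteq> {x, y, z} \<longleftrightarrow> q = {x, y} \<or> q = {y, z} \<or> q = {x, z}"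
    using assms by (auto simp: k_subsets_def card_2_iff)
  have "{x, y} \<noteq> {y, z}" "{x, y} \<noteq> {x, z}" "{y, z} \<noteq> {x, z}"
    using assms by (auto simp: doubleton_eq_iff)
  then show "boundary_col n {x, y, z} q = (unit_vec {x, y} + unit_vec {y, z} + unit_vec {x, z}) q"
    unfolding boundary_col_def eq unit_vec_def plus_fun_apply
    by (cases "q = {x, y}"; cases "q = {y, z}"; cases "q = {x, z}") simp_all
qed

lemma vector_space_bit: "vector_space ((*) :: bit \<Rightarrow> bit \<Rightarrow> bit)"
  by unfold_locales (simp_all only: distrib_left distrib_right mult.assoc mult_1_left)

interpretation F2_functional: vector_space_pair scaleF2 "(*) :: bit \<Rightarrow> bit \<Rightarrow> bit"
  by (intro vector_space_pair.intro vector_space_bit F2.vector_space_axioms)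

text \<open>On columns a functional acts as a graph, formed by the pairs whose unit vector it sends
  to 1; additivity turns the three edges of a triple into a parity.\<close>

lemma functional_col_iff:
  assumes "Vector_Spaces.linear scaleF2 ((*) :: bit \<Rightarrow> bit \<Rightarrow> bit) \<phi>"
    and "x \<in> {1..n}" "y \<in> {1..n}" "z \<in> {1..n}" "x \<noteq> y" "y \<noteq> z" "x \<noteq> z"
  shows "\<phi> (boundary_col n {x, y, z}) = 1 \<longleftrightarrow> odd_tri (\<lambda>x y. \<phi> (unit_vec {x, y}) = 1) x y z"
proof -
  interpret \<phi>: Vector_Spaces.linear scaleF2 "(*) :: bit \<Rightarrow> bit \<Rightarrow> bit" \<phi> by fact
  have "\<phi> (boundary_col n {x, y, z}) =
      \<phi> (unit_vec {x, y}) + \<phi> (unit_vec {y, z}) + \<phi> (unit_vec {x, z})"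
    by (simp only: boundary_col_triple[OF assms(2-)] \<phi>.add)
  then show ?thesis
    by (cases "\<phi> (unit_vec {x, y})"; cases "\<phi> (unit_vec {y, z})"; cases "\<phi> (unit_vec {x, z})")
      (simp_all add: odd_tri_def)
qed

lemma functional_of_graph:
  assumes "symp E"
  obtains \<phi> where "Vector_Spaces.linear scaleF2 ((*) :: bit \<Rightarrow> bit \<Rightarrow> bit) \<phi>"
    and "\<And>\<sigma>. \<sigma> \<in> triples n \<Longrightarrow> \<phi> (boundary_col n \<sigma>) = 1 \<longleftrightarrow> \<sigma> \<in> coboundary n E"
proof
  define P where "P = {{x, y} |x y. x \<in> {1..n} \<and> y \<in> {1..n} \<and> E x y}"
  define \<phi> :: "(nat set \<Rightarrow> bit) \<Rightarrow> bit" where "\<phi> v = (\<Sum>p\<in>P. v p)" for v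
  have "P \<subseteq> Pow {1..n}"
    by (auto simp: P_def)
  then have fin: "finite P"
    by (rule finite_subset) simp
  show lin: "Vector_Spaces.linear scaleF2 ((*) :: bit \<Rightarrow> bit \<Rightarrow> bit) \<phi>"
    unfolding Vector_Spaces.linear_iff \<phi>_def plus_fun_apply scaleF2_def
    by (intro conjI allI vector_space_bit F2.vector_space_axioms[unfolded scaleF2_def]
        sum.distrib sum_distrib_left[symmetric])
  have unit: "\<phi> (unit_vec {x, y}) = 1 \<longleftrightarrow> E x y" if "x \<in> {1..n}" "y \<in> {1..n}" for x y
  proof -
    have "\<phi> (unit_vec {x, y}) = of_bool ({x, y} \<in> P)"
      using fin by (simp add: \<phi>_def unit_vec_def of_bool_def sum.delta)
    moreover have "{x, y} \<in> P \<longleftrightarrow> E x y"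
      using that \<open>symp E\<close> by (auto simp: P_def doubleton_eq_iff dest: sympD)
    ultimately show ?thesis
      by simp
  qed
  fix \<sigma> assume "\<sigma> \<in> triples n"
  then obtain x y z where xyz: "x \<in> {1..n}" "y \<in> {1..n}" "z \<in> {1..n}" "\<sigma> = {x, y, z}"
    "x \<noteq> y" "y \<noteq> z" "x \<noteq> z"
    by (rule triplesE)
  show "\<phi> (boundary_col n \<sigma>) = 1 \<longleftrightarrow> \<sigma> \<in> coboundary n E"
    unfolding xyz(4) functional_col_iff[OF lin xyz(1-3) xyz(5-7)]
      mem_coboundary_iff[OF assms xyz(1-3) xyz(5-7)] odd_tri_def
      unit[OF xyz(1,2)] unit[OF xyz(2,3)] unit[OF xyz(1,3)] ..
qed

lemma hypertree_span:
  assumes "hypertree n T" "\<sigma> \<in> triples n"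
  shows "boundary_col n \<sigma> \<in> F2.span (boundary_col n ` T)"
proof (rule ccontr)
  assume notin: "boundary_col n \<sigma> \<notin> F2.span (boundary_col n ` T)"
  have T: "T \<subseteq> triples n" "F2.independent (boundary_col n ` T)"
    using assms(1) by (auto simp: hypertree_def acyclic_triples_def)
  have "F2.independent (boundary_col n ` insert \<sigma> T)"
    using F2.independent_insertI[OF notin T(2)] by simp
  then have "acyclic_triples n (insert \<sigma> T)"
    using T(1) assms(2) by (auto simp: acyclic_triples_def)
  then have "insert \<sigma> T = T"
    using assms(1) unfolding hypertree_def by blast
  then show False
    using notin by (metis F2.span_base image_eqI insertI1)
qed

text \<open>Duality: \<open>C\<close> misses some hypertree exactly when the columns outside
  \<open>C\<close> span all columns. If they do not, a functional vanishing on them but not on every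
  column yields the graph. Conversely, the functional of a graph with nonempty coboundary cannot
  vanish on a whole hypertree, because a hypertree spans all columns.\<close>

lemma meets_all_hypertrees_iff:
  "meets_all_hypertrees n C \<longleftrightarrow>
    (\<exists>E. symp E \<and> coboundary n E \<noteq> {} \<and> coboundary n E \<subseteq> C)"
proof
  assume meets: "meets_all_hypertrees n C"
  let ?F = "triples n - C"
  obtain B where B: "B \<subseteq> boundary_col n ` ?F" "F2.independent B" "boundary_col n ` ?F \<subseteq> F2.span B"
    using F2.maximal_independent_subset by blast
  \<comment> \<open>If the basis \<open>B\<close> of the outside columns spanned every column, the
    triples behind it would form a hypertree disjoint from \<open>C\<close>.\<close>
  have "\<exists>\<sigma>\<in>triples n. boundary_col n \<sigma> \<notin> F2.span B"
  proof (rule ccontr)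
    assume "\<not> ?thesis"
    then have span: "boundary_col n \<sigma> \<in> F2.span B" if "\<sigma> \<in> triples n" for \<sigma>
      using that by blast
    define T where "T = {\<sigma> \<in> ?F. boundary_col n \<sigma> \<in> B}"
    have T: "T \<subseteq> ?F" "boundary_col n ` T = B"
      using B(1) by (auto simp: T_def)
    have "hypertree n T"
      unfolding hypertree_def
    proof (intro conjI allI impI)
      show "acyclic_triples n T"
        using T B(2) by (auto simp: acyclic_triples_def)
      fix F assume F: "acyclic_triples n F" "T \<subseteq> F"
      show "F = T"
      proof (rule ccontr)
        assume "F \<noteq> T"
        then obtain \<sigma> where \<sigma>: "\<sigma> \<in> F" "\<sigma> \<notin> T"
          using F(2) by blast
        have sub: "F \<subseteq> triples n"
          using F(1) by (simp add: acyclic_triples_def)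
        have "boundary_col n \<sigma> \<notin> boundary_col n ` T"
          using boundary_col_inj[of n] \<sigma> F(2) sub by (auto dest!: inj_onD)
        then have "boundary_col n ` T \<subseteq> boundary_col n ` F - {boundary_col n \<sigma>}"
          using F(2) by blast
        then have "boundary_col n \<sigma> \<in> F2.span (boundary_col n ` F - {boundary_col n \<sigma>})"
          using span[of \<sigma>] \<sigma>(1) sub T(2) F2.span_mono by blast
        then show False
          using F(1) \<sigma>(1) unfolding acyclic_triples_def F2.dependent_def by blast
      qed
    qed
    then show False
      using meets T(1) unfolding meets_all_hypertrees_def by blast
  qed
  then obtain \<sigma> where \<sigma>: "\<sigma> \<in> triples n" "boundary_col n \<sigma> \<notin> F2.span B"
    by blast
  have "F2.independent (insert (boundary_col n \<sigma>) B)"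
    using \<sigma>(2) B(2) by (rule F2.independent_insertI)
  from F2_functional.linear_independent_extend[OF this, of "\<lambda>v. of_bool (v = boundary_col n \<sigma>)"]
  obtain \<phi> where lin: "Vector_Spaces.linear scaleF2 ((*) :: bit \<Rightarrow> bit \<Rightarrow> bit) \<phi>"
    and \<phi>: "\<forall>v\<in>insert (boundary_col n \<sigma>) B. \<phi> v = of_bool (v = boundary_col n \<sigma>)"
    by blast
  interpret \<phi>: Vector_Spaces.linear scaleF2 "(*) :: bit \<Rightarrow> bit \<Rightarrow> bit" \<phi> by fact
  have \<phi>B: "\<phi> v = 0" if "v \<in> B" for v
    using bspec[OF \<phi>, of v] that \<sigma>(2) F2.span_base by fastforce
  have \<phi>0: "\<phi> v = 0" if "v \<in> F2.span B" for v
    using that by (rule F2_functional.linear_eq_0_on_span[OF lin \<phi>B, rotated])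
  define E where "E = (\<lambda>x y. \<phi> (unit_vec {x, y}) = 1)"
  have sym: "symp E"
    by (auto simp: E_def symp_def insert_commute)
  have iff: "\<tau> \<in> coboundary n E \<longleftrightarrow> \<phi> (boundary_col n \<tau>) = 1" if "\<tau> \<in> triples n" for \<tau>
    using that
  proof (rule triplesE)
    fix x y z
    assume *: "x \<in> {1..n}" "y \<in> {1..n}" "z \<in> {1..n}" "\<tau> = {x, y, z}" "x \<noteq> y" "y \<noteq> z" "x \<noteq> z"
    show ?thesis
      using functional_col_iff[OF lin *(1-3) *(5-7)] mem_coboundary_iff[OF sym *(1-3) *(5-7)] *(4)
      by (simp add: E_def)
  qed
  have "\<sigma> \<in> coboundary n E"
    using iff[OF \<sigma>(1)] bspec[OF \<phi> insertI1] by simp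
  moreover have "coboundary n E \<subseteq> C"
  proof
    fix \<tau> assume \<tau>: "\<tau> \<in> coboundary n E"
    then have tri: "\<tau> \<in> triples n"
      using coboundary_subset by blast
    show "\<tau> \<in> C"
    proof (rule ccontr)
      assume "\<tau> \<notin> C"
      then have "\<phi> (boundary_col n \<tau>) = 0"
        using B(3) tri \<phi>0 by blast
      then show False
        using iff[OF tri] \<tau> by (metis zero_neq_one)
    qed
  qed
  ultimately show "\<exists>E. symp E \<and> coboundary n E \<noteq> {} \<and> coboundary n E \<subseteq> C"
    using sym by blast
next
  assume "\<exists>E. symp E \<and> coboundary n E \<noteq> {} \<and> coboundary n E \<subseteq> C"
  then obtain E \<sigma> where E: "symp E" "\<sigma> \<in> coboundary n E" "coboundary n E \<subseteq> C"
    by blast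
  obtain \<phi> where lin: "Vector_Spaces.linear scaleF2 ((*) :: bit \<Rightarrow> bit \<Rightarrow> bit) \<phi>"
    and \<phi>: "\<And>\<sigma>. \<sigma> \<in> triples n \<Longrightarrow> \<phi> (boundary_col n \<sigma>) = 1 \<longleftrightarrow> \<sigma> \<in> coboundary n E"
    using functional_of_graph[OF E(1), of n] by blast
  have \<sigma>: "\<sigma> \<in> triples n"
    using E(2) coboundary_subset by blast
  show "meets_all_hypertrees n C"
    unfolding meets_all_hypertrees_def
  proof (intro allI impI notI)
    fix T assume T: "hypertree n T" "C \<inter> T = {}"
    have "\<phi> v = 0" if v: "v \<in> boundary_col n ` T" for v
    proof -
      obtain \<tau> where "\<tau> \<in> T" "v = boundary_col n \<tau>"
        using v by blast
      moreover have "\<tau> \<in> triples n"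
        using \<open>\<tau> \<in> T\<close> T(1) by (auto simp: hypertree_def acyclic_triples_def)
      ultimately have "\<phi> v \<noteq> 1"
        using \<phi>[of \<tau>] T(2) E(3) by blast
      then show ?thesis
        by simp
    qed
    then have "\<phi> (boundary_col n \<sigma>) = 0"
      by (rule F2_functional.linear_eq_0_on_span[OF lin _ hypertree_span[OF T(1) \<sigma>]])
    then show False
      using \<phi>[OF \<sigma>] E(2) by simp
  qed
qed

text \<open>Nonempty coboundaries meet all hypertrees, and every set meeting all hypertrees contains
  one, so both families have the same minimal members.\<close>

lemma hypercut_iff:
  "hypercut n C \<longleftrightarrow> C \<noteq> {} \<and> (\<exists>E. symp E \<and> C = coboundary n E) \<and>
    (\<forall>E. symp E \<longrightarrow> coboundary n E \<noteq> {} \<longrightarrow> coboundary n E \<subseteq> C \<longrightarrow> coboundary n E = C)"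
    (is "?L \<longleftrightarrow> ?R")
proof
  assume ?L
  then have min: "\<And>D. D \<subset> C \<Longrightarrow> \<not> meets_all_hypertrees n D" and "meets_all_hypertrees n C"
    unfolding hypercut_def by blast+
  obtain E where E: "symp E" "coboundary n E \<noteq> {}" "coboundary n E \<subseteq> C"
    using \<open>meets_all_hypertrees n C\<close> meets_all_hypertrees_iff by blast
  have *: "coboundary n E' = C"
    if "symp E'" "coboundary n E' \<noteq> {}" "coboundary n E' \<subseteq> C" for E'
    using min[of "coboundary n E'"] that meets_all_hypertrees_iff by blast
  show ?R
    using E * by blast
next
  assume R: ?R
  then obtain E where E: "symp E" "C = coboundary n E" "C \<noteq> {}"
    by blast
  have "meets_all_hypertrees n C"
    unfolding meets_all_hypertrees_iff using E by blast
  moreover have "\<not> meets_all_hypertrees n D" if "D \<subset> C" for D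
  proof
    assume "meets_all_hypertrees n D"
    then obtain E' where "symp E'" "coboundary n E' \<noteq> {}" "coboundary n E' \<subseteq> D"
      unfolding meets_all_hypertrees_iff by blast
    then show False
      using R that by blast
  qed
  ultimately show ?L
    unfolding hypercut_def using E(2) coboundary_subset by blast
qed

section \<open>Counting odd triples\<close>

definition deg :: "('a \<Rightarrow> 'a \<Rightarrow> bool) \<Rightarrow> 'a set \<Rightarrow> 'a \<Rightarrow> nat" where
  "deg E U x = card {y \<in> U. E x y}"

text \<open>
  The sum runs over ordered triples; one with a repeated vertex is never odd in a loopless graph, so
  this is six times the number of odd triples.
\<close>

definition odd_count :: "('a \<Rightarrow> 'a \<Rightarrow> bool) \<Rightarrow> 'a set \<Rightarrow> real" where
  "odd_count E V = (\<Sum>x\<in>V. \<Sum>y\<in>V. \<Sum>z\<in>V. of_bool (odd_tri E x y z))"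

text \<open>Six times the number of triangles of a loopless symmetric graph, in line with the
  scaling of \<open>odd_count\<close>.\<close>

definition tri_count :: "('a \<Rightarrow> 'a \<Rightarrow> bool) \<Rightarrow> 'a set \<Rightarrow> real" where
  "tri_count E V = (\<Sum>x\<in>V. \<Sum>y\<in>V. \<Sum>z\<in>V. of_bool (E x y) * of_bool (E y z) * of_bool (E x z))"

section \<open>Degree sums and the parity polynomial\<close>

lemma real_deg: "finite U \<Longrightarrow> real (deg E U x) = (\<Sum>y\<in>U. of_bool (E x y))"
  by (simp add: deg_def of_bool_def sum.If_cases Int_def)

lemma sum_deg_swap:
  assumes "symp E" "finite U" "finite W"
  shows "(\<Sum>x\<in>U. deg E W x) = (\<Sum>y\<in>W. deg E U y)"
proof -
  have "(\<Sum>x\<in>U. \<Sum>y\<in>W. of_bool (E x y)) = (\<Sum>y\<in>W. \<Sum>x\<in>U. of_bool (E y x) :: real)"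
    using \<open>symp E\<close> by (subst sum.swap) (intro sum.cong refl, auto dest: sympD)
  then have "real (\<Sum>x\<in>U. deg E W x) = real (\<Sum>y\<in>W. deg E U y)"
    using assms by (simp add: real_deg)
  then show ?thesis
    by linarith
qed

lemma deg_split:
  assumes "finite V" "U \<subseteq> V"
  shows "deg E V x = deg E U x + deg E (V - U) x"
proof -
  have "{y \<in> V. E x y} = {y \<in> U. E x y} \<union> {y \<in> V - U. E x y}"
    using assms(2) by auto
  then show ?thesis
    using assms finite_subset[OF assms(2,1)] by (simp add: deg_def card_Un_disjoint disjnt_def disjoint_iff)
qed

lemma deg_le_card: "finite U \<Longrightarrow> deg E U x \<le> card U"
  by (simp add: deg_def card_mono)

lemma odd_tri_of_bool:
  "(of_bool (odd_tri E x y z) :: real) =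
     of_bool (E x y) + of_bool (E y z) + of_bool (E x z)
     - 2 * (of_bool (E x y) * of_bool (E y z) + of_bool (E x z) * of_bool (E y z)
        + of_bool (E x y) * of_bool (E x z))
     + 4 * (of_bool (E x y) * of_bool (E y z) * of_bool (E x z))"
  by (simp add: odd_tri_def of_bool_def)

text \<open>Sum the polynomial form of the parity: each linear term gives \<open>card V\<close>
  times the degree sum, and each product of two edges counts walks of length two by their middle
  vertex, hence squared degrees.\<close>

lemma odd_count_eq:
  assumes "symp E" "finite V"
  shows "odd_count E V = 3 * real (card V) * (\<Sum>x\<in>V. real (deg E V x))
    - 6 * (\<Sum>x\<in>V. (real (deg E V x))\<^sup>2) + 4 * tri_count E V"
proof -
  let ?a = "\<lambda>x y. of_bool (E x y) :: real"
  let ?n = "real (card V)" and ?d = "\<lambda>x. real (deg E V x)"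
  have sym: "?a x y = ?a y x" for x y
    using \<open>symp E\<close> by (auto dest: sympD)
  have row: "(\<Sum>y\<in>V. ?a x y) = ?d x" and col: "(\<Sum>y\<in>V. ?a y x) = ?d x" for x
    using real_deg[OF assms(2), of E x] by (simp_all add: sym[of _ x])
  have "(\<Sum>x\<in>V. \<Sum>y\<in>V. \<Sum>z\<in>V. ?a x y) = ?n * (\<Sum>x\<in>V. ?d x)"
    by (simp add: row flip: sum_distrib_left)
  moreover have "(\<Sum>x\<in>V. \<Sum>y\<in>V. \<Sum>z\<in>V. ?a y z) = ?n * (\<Sum>x\<in>V. ?d x)"
    by (simp add: row)
  moreover have "(\<Sum>x\<in>V. \<Sum>y\<in>V. \<Sum>z\<in>V. ?a x z) = ?n * (\<Sum>x\<in>V. ?d x)"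
    by (simp add: row flip: sum_distrib_left)
  moreover have "(\<Sum>x\<in>V. \<Sum>y\<in>V. \<Sum>z\<in>V. ?a x y * ?a y z) = (\<Sum>x\<in>V. (?d x)\<^sup>2)"
    by (subst sum.swap) (simp add: row col power2_eq_square flip: sum_distrib_left sum_distrib_right)
  moreover have "(\<Sum>x\<in>V. \<Sum>y\<in>V. \<Sum>z\<in>V. ?a x z * ?a y z) = (\<Sum>x\<in>V. (?d x)\<^sup>2)"
  proof -
    have "(\<Sum>x\<in>V. \<Sum>y\<in>V. \<Sum>z\<in>V. ?a x z * ?a y z) = (\<Sum>x\<in>V. \<Sum>z\<in>V. \<Sum>y\<in>V. ?a x z * ?a y z)"
      by (intro sum.cong refl sum.swap)
    also have "\<dots> = (\<Sum>z\<in>V. \<Sum>x\<in>V. \<Sum>y\<in>V. ?a x z * ?a y z)"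
      by (rule sum.swap)
    finally show ?thesis
      by (simp add: col power2_eq_square flip: sum_distrib_left sum_distrib_right)
  qed
  moreover have "(\<Sum>x\<in>V. \<Sum>y\<in>V. \<Sum>z\<in>V. ?a x y * ?a x z) = (\<Sum>x\<in>V. (?d x)\<^sup>2)"
    by (simp add: row power2_eq_square flip: sum_distrib_left sum_distrib_right)
  ultimately show ?thesis
    unfolding odd_count_def tri_count_def odd_tri_of_bool
    by (simp add: sum.distrib sum_subtractf flip: sum_distrib_left)
qed

lemma sum_deg_remove:
  assumes "symp E" "irreflp E" "finite V" "c \<in> V"
  shows "(\<Sum>x\<in>V. deg E V x) = 2 * deg E V c + (\<Sum>x\<in>V - {c}. deg E (V - {c}) x)"
proof -
  have "{y \<in> {c}. E x y} = (if E x c then {c} else {})" for x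
    by auto
  then have deg_1: "deg E {c} x = of_bool (E x c)" for x
    by (simp add: deg_def)
  have "V - (V - {c}) = {c}"
    using assms(4) by auto
  then have split: "deg E V x = deg E (V - {c}) x + of_bool (E x c)" for x
    using deg_split[OF assms(3), of "V - {c}" E x] deg_1 by simp
  have "(\<Sum>x\<in>V - {c}. of_bool (E x c)) = (\<Sum>x\<in>V - {c}. deg E {c} x)"
    by (simp add: deg_1)
  also have "\<dots> = deg E (V - {c}) c"
    using sum_deg_swap[OF assms(1), of "V - {c}" "{c}"] assms(3) by simp
  also have "\<dots> = deg E V c"
    using assms(2) split[of c] by (simp add: irreflp_def)
  finally have cross: "(\<Sum>x\<in>V - {c}. of_bool (E x c)) = deg E V c" .
  have "(\<Sum>x\<in>V. deg E V x) = deg E V c + (\<Sum>x\<in>V - {c}. deg E V x)"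
    using assms(3,4) by (rule sum.remove)
  also have "(\<Sum>x\<in>V - {c}. deg E V x) = (\<Sum>x\<in>V - {c}. deg E (V - {c}) x) + deg E V c"
    by (simp only: split sum.distrib cross[unfolded split])
  finally show ?thesis
    by simp
qed

lemma tri_count_nonneg: "tri_count E V \<ge> 0"
  unfolding tri_count_def by (intro sum_nonneg) simp

text \<open>The vertex \<open>c\<close> may stand at any of the three places of an ordered triple,
  whence the factor 3; triangles avoiding \<open>c\<close> are discarded.\<close>

lemma tri_count_ge_hub:
  assumes "symp E" "irreflp E" "finite V" "c \<in> V"
  shows "tri_count E V \<ge>
    3 * (\<Sum>x\<in>V - {c}. \<Sum>y\<in>V - {c}. of_bool (E x c \<and> E y c \<and> E x y))"
proof -
  let ?a = "\<lambda>x y. of_bool (E x y) :: real"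
  let ?U = "V - {c}"
  let ?t = "\<Sum>x\<in>?U. \<Sum>y\<in>?U. of_bool (E x c \<and> E y c \<and> E x y) :: real"
  have sym: "E x y = E y x" for x y
    using \<open>symp E\<close> by (metis sympD)
  have [simp]: "\<not> E x x" for x
    using \<open>irreflp E\<close> by (simp add: irreflp_def)
  have split: "(\<Sum>x\<in>V. f x) = f c + (\<Sum>x\<in>?U. f x)" for f :: "'a \<Rightarrow> real"
    using assms(3,4) by (simp add: sum.remove)
  have "tri_count E V = (\<Sum>y\<in>?U. \<Sum>z\<in>?U. ?a c y * ?a y z * ?a c z)
      + ((\<Sum>x\<in>?U. \<Sum>z\<in>?U. ?a x c * ?a c z * ?a x z)
      + (\<Sum>x\<in>?U. \<Sum>y\<in>?U. ?a x y * ?a y c * ?a x c)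
      + (\<Sum>x\<in>?U. \<Sum>y\<in>?U. \<Sum>z\<in>?U. ?a x y * ?a y z * ?a x z))"
    unfolding tri_count_def split by (simp add: sum.distrib)
  moreover have "(\<Sum>x\<in>?U. \<Sum>y\<in>?U. \<Sum>z\<in>?U. ?a x y * ?a y z * ?a x z) \<ge> 0"
    by (intro sum_nonneg) simp
  moreover have "(\<Sum>y\<in>?U. \<Sum>z\<in>?U. ?a c y * ?a y z * ?a c z) = ?t"
    by (intro sum.cong refl) (auto simp: sym[of c])
  moreover have "(\<Sum>x\<in>?U. \<Sum>z\<in>?U. ?a x c * ?a c z * ?a x z) = ?t"
    by (intro sum.cong refl) (auto simp: sym[of c])
  moreover have "(\<Sum>x\<in>?U. \<Sum>y\<in>?U. ?a x y * ?a y c * ?a x c) = ?t"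
    by (intro sum.cong refl) auto
  ultimately show ?thesis
    by simp
qed

text \<open>The handshake lemma; the order on the vertices pairs the two orientations of each
  edge.\<close>

lemma even_sum_deg:
  fixes V :: "nat set"
  assumes "symp E" "irreflp E" "finite V"
  shows "even (\<Sum>x\<in>V. deg E V x)"
proof -
  let ?L = "SIGMA x:V. {y \<in> V. E x y \<and> x < y}" and ?G = "SIGMA x:V. {y \<in> V. E x y \<and> y < x}"
  have "(\<Sum>x\<in>V. deg E V x) = card (SIGMA x:V. {y \<in> V. E x y})"
    using assms(3) by (simp add: deg_def card_SigmaI)
  also have "(SIGMA x:V. {y \<in> V. E x y}) = ?L \<union> ?G"
    using assms(2) by (auto simp: irreflp_def) (metis linorder_neqE_nat)
  also have "card \<dots> = card ?L + card ?G"
    using assms(3) by (intro card_Un_disjoint) auto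
  also have "card ?L = card ?G"
  proof (rule bij_betw_same_card)
    show "bij_betw prod.swap ?L ?G"
      using assms(1) by (auto simp: bij_betw_def inj_on_def image_iff dest: sympD)
  qed
  finally show ?thesis
    by simp
qed

section \<open>Graphs with a hub\<close>

text \<open>The claimed least number of triples outside a hypercut.\<close>

definition shadow_bound :: "nat \<Rightarrow> real" where
  "shadow_bound n = (if even n then 3/4 * real n ^ 2 - 7/2 * real n + 4
            else 3/4 * real n ^ 2 - 4 * real n + 25/4)"

text \<open>What the proof keeps of minimality. \<open>deg_less\<close> comes from having fewest
  edges under switching; \<open>deg_sum\<close> gives at least \<open>card V - 2\<close> edges, as
  for at most two components; \<open>twin_free\<close> comes from minimality of the
  hypercut.\<close>

locale reduced_graph =
  fixes V :: "nat set" and E :: "nat \<Rightarrow> nat \<Rightarrow> bool"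
  assumes finite_V: "finite V"
    and symp_E: "symp E"
    and irreflp_E: "irreflp E"
    and deg_less: "\<And>x. x \<in> V \<Longrightarrow> 2 * deg E V x < card V"
    and deg_sum: "2 * card V \<le> (\<Sum>x\<in>V. deg E V x) + 4"
    and twin_free: "\<And>x y. x \<in> V \<Longrightarrow> y \<in> V \<Longrightarrow> x \<noteq> y \<Longrightarrow> \<not> E x y \<Longrightarrow>
      \<exists>w\<in>V. E w x \<noteq> E w y"
begin

lemma E_commute: "E x y \<longleftrightarrow> E y x"
  using symp_E by (metis sympD)

lemma E_irrefl [simp]: "\<not> E x x"
  using irreflp_E by (simp add: irreflp_def)

text \<open>Expands \<open>odd_count_eq\<close> around \<open>c\<close>: a degree is the degree in
  \<open>E - c\<close> plus 1 at neighbours of \<open>c\<close>. The mixed term of the square counts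
  edges of \<open>E - c\<close> from ends adjacent to \<open>c\<close>; triangles through
  \<open>c\<close> cancel the edges with both ends adjacent to \<open>c\<close>, which leaves
  \<open>m\<close>.\<close>

lemma hub_count:
  fixes c :: nat
  assumes "c \<in> V"
  defines "U \<equiv> V - {c}"
  defines "J \<equiv> (\<Sum>x\<in>U. deg E U x)"
  defines "m \<equiv> (\<Sum>x\<in>U. card {y \<in> U. E x y \<and> E x c \<and> \<not> E y c})"
  defines "Q \<equiv> (\<Sum>x\<in>U. (deg E U x)\<^sup>2) + 2 * m"
  defines "D \<equiv> real (deg E V c)"
  shows "odd_count E V \<ge> 6 * (D * (real (card V) - 1 - D) + real (card V) * real J / 2 - real Q)"
proof -
  let ?n = "real (card V)" and ?i = "\<lambda>x. real (deg E U x)" and ?a = "\<lambda>x. of_bool (E x c) :: real"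
  let ?t = "\<Sum>x\<in>U. \<Sum>y\<in>U. of_bool (E x c \<and> E y c \<and> E x y) :: real"
  have finU: "finite U"
    using finite_V by (simp add: U_def)
  have "{y \<in> {c}. E x y} = (if E x c then {c} else {})" for x
    by auto
  then have deg_1: "deg E {c} x = of_bool (E x c)" for x
    by (simp add: deg_def)
  have "V - U = {c}"
    using assms(1) by (auto simp: U_def)
  then have deg_c: "deg E V x = deg E U x + of_bool (E x c)" for x
    using deg_split[OF finite_V, of U E x] deg_1 by (simp add: U_def)
  have Da: "D = (\<Sum>x\<in>U. ?a x)"
    using deg_c[of c] real_deg[OF finU, of E c] by (simp add: D_def E_commute[of c])
  have dx: "real (deg E V x) = ?i x + ?a x" for x
    by (simp add: deg_c)
  have "(\<Sum>x\<in>V. deg E V x) = 2 * deg E V c + J"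
    unfolding J_def U_def by (rule sum_deg_remove[OF symp_E irreflp_E finite_V assms(1)])
  then have "real (\<Sum>x\<in>V. deg E V x) = real (2 * deg E V c + J)"
    by (rule arg_cong)
  then have s1: "(\<Sum>x\<in>V. real (deg E V x)) = 2 * D + real J"
    by (simp add: D_def)
  have *: "(?i x + ?a x)\<^sup>2 = (?i x)\<^sup>2 + 2 * (?a x * ?i x) + ?a x" for x
    by (simp add: power2_eq_square algebra_simps)
  have s2: "(\<Sum>x\<in>V. (real (deg E V x))\<^sup>2) =
      D\<^sup>2 + (\<Sum>x\<in>U. (?i x)\<^sup>2) + 2 * (\<Sum>x\<in>U. ?a x * ?i x) + D"
  proof -
    have "(\<Sum>x\<in>V. (real (deg E V x))\<^sup>2) = D\<^sup>2 + (\<Sum>x\<in>U. (real (deg E V x))\<^sup>2)"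
      using assms(1) finite_V by (simp add: sum.remove D_def U_def)
    then show ?thesis
      unfolding dx * sum.distrib by (simp add: Da sum_distrib_left)
  qed
  have "real (card {y \<in> U. E x y \<and> E x c \<and> \<not> E y c}) =
      ?a x * ?i x - (\<Sum>y\<in>U. of_bool (E x c \<and> E y c \<and> E x y))" for x
  proof -
    have "real (card {y \<in> U. E x y \<and> E x c \<and> \<not> E y c}) =
        (\<Sum>y\<in>U. of_bool (E x y \<and> E x c \<and> \<not> E y c))"
      using finU by (simp add: of_bool_def sum.If_cases Int_def)
    also have "\<dots> = (\<Sum>y\<in>U. ?a x * of_bool (E x y) - of_bool (E x c \<and> E y c \<and> E x y))"
      by (intro sum.cong refl) auto
    finally show ?thesis
      by (simp add: sum_subtractf real_deg[OF finU] flip: sum_distrib_left)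
  qed
  then have m: "real m = (\<Sum>x\<in>U. ?a x * ?i x) - ?t"
    by (simp add: m_def sum_subtractf)
  have tri: "tri_count E V \<ge> 3 * ?t"
    unfolding U_def by (intro tri_count_ge_hub symp_E irreflp_E finite_V assms(1))
  have "odd_count E V = 3 * ?n * (2 * D + J)
      - 6 * (D\<^sup>2 + (\<Sum>x\<in>U. (?i x)\<^sup>2) + 2 * (\<Sum>x\<in>U. ?a x * ?i x) + D) + 4 * tri_count E V"
    using odd_count_eq[OF symp_E finite_V] by (simp only: s1 s2)
  moreover have "real Q = (\<Sum>x\<in>U. (?i x)\<^sup>2) + 2 * ((\<Sum>x\<in>U. ?a x * ?i x) - ?t)"
    by (simp add: Q_def flip: m)
  ultimately show "odd_count E V \<ge> 6 * (D * (?n - 1 - D) + ?n * real J / 2 - real Q)"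
    using tri by (simp add: algebra_simps power2_eq_square)
qed

text \<open>
  \<open>X \<le> 1\<close> needs the sharp estimate \<open>Q \<le> 2 * J\<close>, because \<open>J\<close> may then be as small as
  parity allows; for larger \<open>X\<close> the crude one is compensated by the growth of \<open>J\<close>.
\<close>

lemma hub_local:
  fixes c :: nat
  assumes "c \<in> V" and deg_small: "\<forall>x\<in>V - {c}. 100 * deg E V x \<le> card V"
  defines "U \<equiv> V - {c}"
  defines "J \<equiv> (\<Sum>x\<in>U. deg E U x)"
  defines "m \<equiv> (\<Sum>x\<in>U. card {y \<in> U. E x y \<and> E x c \<and> \<not> E y c})"
  defines "Q \<equiv> (\<Sum>x\<in>U. (deg E U x)\<^sup>2) + 2 * m"
  defines "X \<equiv> (\<Sum>x\<in>U. deg E U x - 1)"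
  shows "card V + X \<le> J + 3" and "100 * Q \<le> 200 * J + card V * X"
    and "X \<le> 1 \<Longrightarrow> Q \<le> 2 * J" and "even J"
proof -
  let ?i = "\<lambda>x. deg E U x"
  have finU: "finite U"
    using finite_V by (simp add: U_def)
  show "even J"
    unfolding J_def by (intro even_sum_deg symp_E irreflp_E finU)
  define Z where "Z = {x \<in> U. ?i x = 0}"
  have no_nb: "\<not> E x y" if "?i x = 0" "y \<in> U" for x y
    using that finU by (auto simp: deg_def)
  \<comment> \<open>Vertices isolated in \<open>E - c\<close> can differ only in their adjacency to
    \<open>c\<close>, so \<open>twin_free\<close> leaves at most two of them.\<close>
  have "inj_on (\<lambda>x. E x c) Z"
  proof (rule inj_onI, rule ccontr)
    fix x y assume xy: "x \<in> Z" "y \<in> Z" "E x c = E y c" "x \<noteq> y"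
    have "\<exists>w\<in>V. E w x \<noteq> E w y"
      using xy no_nb by (intro twin_free) (auto simp: Z_def U_def)
    then obtain w where "w \<in> V" "E x w \<noteq> E y w"
      using E_commute by blast
    then show False
      using xy no_nb[of x w] no_nb[of y w] by (cases "w = c") (auto simp: Z_def U_def)
  qed
  then have "card Z \<le> card (UNIV :: bool set)"
    by (intro card_inj_on_le[of _ _ UNIV]) auto
  then have Z2: "card Z \<le> 2"
    by simp
  have cardZ: "(\<Sum>x\<in>U. of_bool (?i x = 0)) = card Z"
    using finU by (simp add: Z_def of_bool_def sum.If_cases Int_def)
  \<comment> \<open>The subtraction in \<open>X\<close> is truncated: isolated vertices contribute 0
    instead of -1, which \<open>card Z\<close> corrects.\<close>
  have "X + card U = (\<Sum>x\<in>U. (?i x - 1) + 1)"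
    unfolding sum.distrib X_def by simp
  also have "\<dots> = (\<Sum>x\<in>U. ?i x + of_bool (?i x = 0))"
    by (intro sum.cong refl) auto
  also have "\<dots> = J + card Z"
    unfolding sum.distrib J_def cardZ ..
  finally have "X + card U = J + card Z" .
  moreover have "card V = card U + 1"
    using card.remove[OF finite_V assms(1)] by (simp add: U_def)
  ultimately show "card V + X \<le> J + 3"
    using Z2 by linarith
  \<comment> \<open>Oriented edges of \<open>E - c\<close> are sorted by the adjacency of their ends
    to \<open>c\<close>. Both mixed classes have size \<open>m\<close>, so
    \<open>J = 2 * m + card ?P\<close>.\<close>
  let ?P10 = "SIGMA x:U. {y \<in> U. E x y \<and> E x c \<and> \<not> E y c}"
  let ?P01 = "SIGMA x:U. {y \<in> U. E x y \<and> \<not> E x c \<and> E y c}"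
  let ?P = "SIGMA x:U. {y \<in> U. E x y \<and> (E x c \<longleftrightarrow> E y c)}"
  have fins: "finite ?P" "finite ?P01" "finite ?P10"
    using finU by auto
  have m10: "m = card ?P10"
    using finU by (simp add: m_def card_SigmaI)
  have "bij_betw prod.swap ?P10 ?P01"
    using E_commute by (auto simp: bij_betw_def inj_on_def image_iff)
  then have m01: "m = card ?P01"
    using m10 by (simp add: bij_betw_same_card)
  have "J = card (SIGMA x:U. {y \<in> U. E x y})"
    using finU by (simp add: J_def deg_def card_SigmaI)
  also have "(SIGMA x:U. {y \<in> U. E x y}) = ?P10 \<union> (?P01 \<union> ?P)"
    by auto
  also have "card \<dots> = card ?P10 + (card ?P01 + card ?P)"
    using fins by (subst card_Un_disjoint; (subst card_Un_disjoint)?) auto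
  finally have J: "J = 2 * m + card ?P"
    using m10 m01 by simp
  \<comment> \<open>Consequently \<open>Q + card ?P\<close> is \<open>2 * J\<close> plus the sum of
    \<open>?i x * (?i x - 1)\<close>, and only this last sum has to be controlled.\<close>
  have sq: "(\<Sum>x\<in>U. (?i x)\<^sup>2) = J + (\<Sum>x\<in>U. ?i x * (?i x - 1))"
    unfolding J_def sum.distrib[symmetric]
    by (intro sum.cong refl) (simp add: power2_eq_square algebra_simps)
  have "100 * (?i x * (?i x - 1)) \<le> card V * (?i x - 1)" if "x \<in> U" for x
  proof -
    have "?i x \<le> deg E V x"
      using finite_V by (auto simp: deg_def U_def intro!: card_mono)
    then have "100 * ?i x \<le> card V"
      using bspec[OF deg_small that[unfolded U_def]] by linarith
    then show ?thesis
      by (metis mult.assoc mult_le_mono1)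
  qed
  then have "100 * (\<Sum>x\<in>U. ?i x * (?i x - 1)) \<le> card V * X"
    unfolding X_def sum_distrib_left by (rule sum_mono)
  then show "100 * Q \<le> 200 * J + card V * X"
    unfolding Q_def sq using J by simp
  show "Q \<le> 2 * J" if "X \<le> 1"
  proof (cases "X = 0")
    case True
    then have "\<forall>x\<in>U. ?i x - 1 = 0"
      using finU by (simp add: X_def)
    then have "(\<Sum>x\<in>U. ?i x * (?i x - 1)) = 0"
      by simp
    then show ?thesis
      unfolding Q_def sq using J by simp
  next
    case False
    then have "(\<Sum>x\<in>U. ?i x - 1) = 1"
      using that by (simp add: X_def)
    \<comment> \<open>Exactly one vertex \<open>w\<close> has degree 2 in \<open>E - c\<close>, so
      the excess sum is 2. Its neighbours \<open>p\<close> and \<open>q\<close> are leaves there and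
      would be twins unless \<open>c\<close> separates them. One of them then agrees with
      \<open>w\<close> at \<open>c\<close>, and the two orientations of that edge lie in
      \<open>?P\<close> and absorb the 2.\<close>
    then obtain w where w: "w \<in> U" "?i w - 1 = 1" "\<And>x. x \<in> U \<Longrightarrow> w \<noteq> x \<Longrightarrow> ?i x - 1 = 0"
      using sum_eq_1_iff[OF finU, of "\<lambda>x. ?i x - 1"] by blast
    have "?i x * (?i x - 1) \<le> 2 * (?i x - 1)" if "x \<in> U" for x
      using w(2) w(3)[OF that] by (cases "x = w") auto
    then have "(\<Sum>x\<in>U. ?i x * (?i x - 1)) \<le> 2 * (\<Sum>x\<in>U. ?i x - 1)"
      unfolding sum_distrib_left by (rule sum_mono)
    then have i2: "(\<Sum>x\<in>U. ?i x * (?i x - 1)) \<le> 2"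
      using \<open>(\<Sum>x\<in>U. ?i x - 1) = 1\<close> by simp
    have "card {y \<in> U. E w y} = 2"
      using w(2) by (simp add: deg_def)
    then obtain p q where pq: "{y \<in> U. E w y} = {p, q}" "p \<noteq> q"
      by (auto simp: card_2_iff)
    then have pqU: "p \<in> U" "q \<in> U" "E w p" "E w q"
      by auto
    have only: "y = w" if x: "x = p \<or> x = q" and y: "y \<in> U" "E x y" for x y
    proof -
      have "x \<in> U" "x \<noteq> w" "E x w"
        using x pqU E_commute by auto
      then have "{w, y} \<subseteq> {y \<in> U. E x y}" "?i x \<le> 1"
        using w(1) w(3)[of x] y by auto
      then have "card {w, y} \<le> 1"
        using finU card_mono[of "{y \<in> U. E x y}" "{w, y}"] by (simp add: deg_def)
      then show ?thesis
        by (cases "y = w") auto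
    qed
    have "E p c \<noteq> E q c"
    proof
      assume eq: "E p c = E q c"
      have "\<not> E p q"
        using only[of p q] pqU by auto
      then obtain v where v: "v \<in> V" "E v p \<noteq> E v q"
        using twin_free[of p q] pqU pq(2) by (auto simp: U_def)
      show False
      proof (cases "v = c")
        case True
        then show ?thesis
          using v(2) eq E_commute by blast
      next
        case False
        then have "v \<in> U"
          using v(1) by (simp add: U_def)
        then have "v = w"
          using only[of p v] only[of q v] v(2) E_commute by blast
        then show ?thesis
          using v(2) pqU by blast
      qed
    qed
    then obtain r where r: "r = p \<or> r = q" "E r c = E w c"
      by blast
    then have rw: "r \<in> U" "E w r" "E r w" "r \<noteq> w"
      using pqU E_commute by auto
    then have "{(w, r), (r, w)} \<subseteq> ?P"
      using r(2) w(1) by auto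
    then have "card {(w, r), (r, w)} \<le> card ?P"
      using fins(1) by (rule card_mono[rotated])
    then have "2 \<le> card ?P"
      using rw(4) by simp
    then show ?thesis
      unfolding Q_def sq using J i2 by simp
  qed
qed

text \<open>With \<open>j\<close> edges in \<open>E - c\<close> the edge bound gives
  \<open>D \<ge> n - 2 - j\<close>, while \<open>D\<close> is below \<open>n/2\<close>, where
  \<open>D * (n - 1 - D)\<close> increases. This leaves a concave quadratic in \<open>j\<close>, to
  be evaluated at the least possible \<open>j\<close>.\<close>

lemma odd_count_lower_bound_hub:
  assumes "c \<in> V" "\<forall>x\<in>V - {c}. 100 * deg E V x \<le> card V" "card V \<ge> 100"
  shows "odd_count E V \<ge> 6 * shadow_bound (card V)"
proof -
  define U where "U = V - {c}"
  define J where "J = (\<Sum>x\<in>U. deg E U x)"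
  define Q where "Q = (\<Sum>x\<in>U. (deg E U x)\<^sup>2) +
    2 * (\<Sum>x\<in>U. card {y \<in> U. E x y \<and> E x c \<and> \<not> E y c})"
  define X where "X = (\<Sum>x\<in>U. deg E U x - 1)"
  note local_facts = hub_local[OF assms(1,2), folded U_def, folded J_def Q_def X_def]
  note count_fact = hub_count[OF assms(1), folded U_def, folded J_def Q_def]
  obtain j where j: "J = 2 * j"
    using local_facts(4) by auto
  define n where "n = card V"
  define D where "D = deg E V c"
  let ?n = "real n" and ?D = "real D" and ?j = "real j" and ?X = "real X"
  \<comment> \<open>The count for \<open>D = n - 2 - j\<close> and \<open>Q = 4 * j\<close>, as a
    function of \<open>j\<close>.\<close>
  define F where "F = (\<lambda>x::real. (?n - 2 - x) * (1 + x) + (?n - 4) * x)"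
  have n: "?n \<ge> 100"
    using assms(3) by (simp add: n_def)
  have D: "2 * ?D + 1 \<le> ?n"
    using deg_less[OF assms(1)] by (simp add: n_def D_def)
  have S: "odd_count E V \<ge> 6 * (?D * (?n - 1 - ?D) + ?n * ?j - real Q)"
    using count_fact by (simp add: j n_def D_def)
  have "2 * n \<le> 2 * D + 2 * j + 4"
    using deg_sum j sum_deg_remove[OF symp_E irreflp_E finite_V assms(1)]
    by (simp add: n_def D_def J_def U_def)
  then have Dj: "?D \<ge> ?n - 2 - ?j"
    by linarith
  have Xj: "?n + ?X \<le> 2 * ?j + 3"
    using local_facts(1) j unfolding n_def by linarith
  have "100 * Q \<le> 400 * j + n * X"
    using local_facts(2) j by (simp add: n_def)
  then have "real (100 * Q) \<le> real (400 * j + n * X)"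
    by (simp only: of_nat_le_iff)
  then have Q: "real Q \<le> 4 * ?j + ?n * ?X / 100"
    by simp
  have Q1: "real Q \<le> 4 * ?j" if "X \<le> 1"
    using local_facts(3)[OF that] j by linarith
  \<comment> \<open>At least \<open>n - 3\<close> of the \<open>n - 1\<close> vertices of
    \<open>E - c\<close> have an edge there, so it has at least \<open>(n - 3) / 2\<close> edges,
    rounded up for even \<open>n\<close>.\<close>
  define j0 where "j0 = (if even n then (?n - 2) / 2 else (?n - 3) / 2)"
  have F0: "F j0 = shadow_bound n"
    by (simp add: F_def j0_def shadow_bound_def field_simps power2_eq_square)
  have j0: "(?n - 3) / 2 \<le> j0" "j0 \<le> (?n - 2) / 2" "0 \<le> j0"
    using n by (auto simp: j0_def field_simps)
  have jj0: "j0 \<le> ?j"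
  proof (cases "even n")
    case True
    then obtain t where t: "n = 2 * t"
      by auto
    then have "t \<le> j + 1"
      using local_facts(1) j unfolding n_def[symmetric] by linarith
    then show ?thesis
      using t by (simp add: j0_def)
  next
    case False
    then show ?thesis
      using Xj by (simp add: j0_def)
  qed
  have "?D * (?n - 1 - ?D) + ?n * ?j - real Q \<ge> F j0"
  proof (cases "?j \<le> ?n - 2")
    case True
    have "0 \<le> (?D - (?n - 2 - ?j)) * (?n - 1 - ?D - (?n - 2 - ?j))"
      using Dj D True by (intro mult_nonneg_nonneg) linarith+
    then have g: "?D * (?n - 1 - ?D) \<ge> (?n - 2 - ?j) * (1 + ?j)"
      by (simp add: algebra_simps)
    have diff: "F ?j - F j0 = (?j - j0) * (2 * ?n - 7 - ?j - j0)"
      by (simp add: F_def algebra_simps)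
    \<comment> \<open>For \<open>j \<le> n - 2\<close> the secant slope of \<open>F\<close> is at
      least about \<open>n / 2\<close>; the margin \<open>n / 4\<close> pays for the excess of
      \<open>Q\<close> over \<open>4 * j\<close>.\<close>
    have "(?j - j0) * (2 * ?n - 7 - ?j - j0) \<ge> (?j - j0) * (?n / 4)"
      using jj0 True j0 n by (intro mult_left_mono) (auto simp: field_simps)
    then have F: "F ?j \<ge> F j0 + (?j - j0) * (?n / 4)"
      using diff by linarith
    have "real Q \<le> 4 * ?j + (?j - j0) * (?n / 4)"
    proof (cases "X \<le> 1")
      case True
      have "0 \<le> (?j - j0) * (?n / 4)"
        using jj0 by simp
      then show ?thesis
        using Q1[OF True] by linarith
    next
      case False
      then have "?X \<ge> 2"
        by linarith
      \<comment> \<open>Here \<open>X - 1 \<le> 2 * (j - j0)\<close>, and \<open>X \<ge> 2\<close>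
        makes \<open>(X - 1) / 2\<close> at least \<open>X / 4\<close>.\<close>
      then have "?X / 4 \<le> ?j - j0"
        using Xj j0 by (simp add: field_simps)
      then have "?X / 4 * (?n / 4) \<le> (?j - j0) * (?n / 4)"
        by (intro mult_right_mono) auto
      moreover have "?n * ?X / 100 \<le> ?X / 4 * (?n / 4)"
        by (simp add: field_simps)
      ultimately show ?thesis
        using Q by linarith
    qed
    then show ?thesis
      using F g unfolding F_def[of] by (simp add: algebra_simps)
  next
    \<comment> \<open>With this many edges away from \<open>c\<close> even the crude bound on
      \<open>Q\<close> gives at least \<open>81/100 * n^2\<close>, more than
      \<open>3/4 * n^2\<close>.\<close>
    case False
    have "?n * ?X \<le> ?n * (2 * ?j)"
      using Xj n by (intro mult_left_mono) auto
    then have "?n * ?j - real Q \<ge> (?n - 4 - ?n / 50) * ?j"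
      using Q by (simp add: algebra_simps)
    moreover have "(?n - 4 - ?n / 50) * ?j \<ge> (?n * (9/10)) * (?n * (9/10))"
      using False n by (intro mult_mono) auto
    ultimately have "?n * ?j - real Q \<ge> (?n * (9/10)) * (?n * (9/10))"
      by linarith
    moreover have "?D * (?n - 1 - ?D) \<ge> 0"
      using D by simp
    moreover have "shadow_bound n \<le> (?n * (9/10)) * (?n * (9/10))"
      using n zero_le_square[of ?n] unfolding shadow_bound_def power2_eq_square
      by (cases "even n"; simp only: if_True if_False; linarith)
    ultimately show ?thesis
      using F0 by linarith
  qed
  then have "6 * F j0 \<le> 6 * (?D * (?n - 1 - ?D) + ?n * ?j - real Q)"
    by (rule mult_left_mono) simp
  then have "6 * F j0 \<le> odd_count E V"
    using S by (rule order_trans)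
  then show ?thesis
    unfolding F0 n_def .
qed

text \<open>At most \<open>k\<close> vertices have large degree. Twin-freeness makes the others span
  about \<open>n / 2\<close> edges or more among themselves, and the edge bound then forces a large
  degree sum on the few. A maximal degree well below \<open>n / 2\<close>, or a second large degree,
  would push the count above \<open>3/4 * n^2\<close>.\<close>

lemma hub_exists:
  fixes k :: nat
  assumes k: "10000 \<le> k" and large: "real (card V) \<ge> 2000 * (2 + real k + (real k)\<^sup>2 + 2 ^ k)"
    and sum_le: "(\<Sum>x\<in>V. real (deg E V x)) \<le> 5 * real (card V)"
    and odd_le: "odd_count E V \<le> 9/2 * (real (card V))\<^sup>2"
  obtains c where "c \<in> V" "\<forall>x\<in>V - {c}. 100 * deg E V x \<le> card V"
proof -
  define n where "n = card V"
  let ?n = "real n" and ?d = "\<lambda>x. real (deg E V x)" and ?k = "real k"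
  \<comment> \<open>A degree sum of at most \<open>5 * n\<close> leaves room for at most 10000
    vertices of degree above \<open>n / 2000\<close>.\<close>
  define B where "B = {x \<in> V. n < 2000 * deg E V x}"
  define M where "M = V - B"
  define \<beta> where "\<beta> = (\<Sum>x\<in>B. ?d x)"
  define \<mu> where "\<mu> = (\<Sum>x\<in>M. ?d x)"
  define I where "I = (\<Sum>x\<in>M. real (deg E M x))"
  define L where "L = ?k + 2 ^ k"
  have fin: "finite B" "finite M" and BM: "B \<subseteq> V" "M \<subseteq> V" "V = B \<union> M" "B \<inter> M = {}"
    using finite_V by (auto simp: B_def M_def)
  have large': "?n \<ge> 2000 * (2 + ?k + ?k\<^sup>2 + 2 ^ k)"
    using large by (simp add: n_def)
  have n_pos: "?n > 0"
    using large' k by (smt (verit) of_nat_0_le_iff zero_le_power2 zero_le_power)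
  then have "V \<noteq> {}"
    by (auto simp: n_def)
  then have "Max (deg E V ` V) \<in> deg E V ` V"
    using finite_V by (intro Max_in) auto
  then obtain c where c: "c \<in> V" and "deg E V c = Max (deg E V ` V)"
    by auto
  then have c_max: "deg E V x \<le> deg E V c" if "x \<in> V" for x
    using finite_V that by simp
  define D where "D = ?d c"
  have split: "(\<Sum>x\<in>V. f x) = (\<Sum>x\<in>B. f x) + (\<Sum>x\<in>M. f x)" for f :: "nat \<Rightarrow> real"
    unfolding BM(3) using fin BM(4) by (rule sum.union_disjoint)
  have nonneg: "\<beta> \<ge> 0" "\<mu> \<ge> 0" "I \<ge> 0"
    by (simp_all add: \<beta>_def \<mu>_def I_def sum_nonneg)
  have tot5: "\<beta> + \<mu> \<le> 5 * ?n"
    using sum_le split[of ?d] by (simp add: \<beta>_def \<mu>_def n_def)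
  have cardB: "card B \<le> k"
  proof -
    have "real (card B) * (?n / 2000) \<le> \<beta>"
      unfolding \<beta>_def by (rule sum_bounded_below) (simp add: B_def)
    then have "real (card B) * ?n \<le> 10000 * ?n"
      using tot5 nonneg by simp
    then show ?thesis
      using n_pos k by simp
  qed
  have cards: "?n = real (card B) + real (card M)"
    using card_Un_disjoint[OF fin BM(4)] BM(3) by (simp add: n_def)
  have D_half: "2 * D \<le> ?n"
    using deg_less[OF c] by (simp add: D_def n_def)
  \<comment> \<open>Two vertices of \<open>M\<close> without neighbours in \<open>M\<close> and with
    equal neighbourhoods in \<open>B\<close> would be twins, so at most \<open>2 ^ k\<close>
    vertices of \<open>M\<close> are isolated within \<open>M\<close>.\<close>
  have I_ge: "I \<ge> ?n - L"
  proof -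
    define Z where "Z = {x \<in> M. deg E M x = 0}"
    have no_nb: "\<not> E x y" if "x \<in> Z" "y \<in> M" for x y
      using that fin(2) by (auto simp: deg_def Z_def)
    have "inj_on (\<lambda>x. {y \<in> B. E x y}) Z"
    proof (rule inj_onI, rule ccontr)
      fix x y assume xy: "x \<in> Z" "y \<in> Z" "{w \<in> B. E x w} = {w \<in> B. E y w}" "x \<noteq> y"
      have "\<exists>w\<in>V. E w x \<noteq> E w y"
        using xy no_nb by (intro twin_free) (auto simp: Z_def M_def)
      then obtain w where "w \<in> V" "E x w \<noteq> E y w"
        using E_commute by blast
      then show False
        using xy no_nb[of x w] no_nb[of y w] BM(3) by blast
    qed
    then have "card Z \<le> card (Pow B)"
      using fin by (intro card_inj_on_le) auto
    also have "\<dots> \<le> 2 ^ k"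
      using fin cardB by (simp add: card_Pow)
    finally have "real (card Z) \<le> 2 ^ k"
      by (metis of_nat_le_iff of_nat_numeral of_nat_power)
    moreover have "real (card (M - Z)) \<le> I"
    proof -
      have "real (card (M - Z)) * 1 \<le> (\<Sum>x\<in>M - Z. real (deg E M x))"
        by (rule sum_bounded_below) (auto simp: Z_def Suc_le_eq)
      also have "\<dots> \<le> I"
        unfolding I_def using fin by (intro sum_mono2) auto
      finally show ?thesis
        by simp
    qed
    moreover have "card M = card Z + card (M - Z)"
      using card_Int_Diff[OF fin(2), of Z] by (simp add: Z_def Int_absorb1)
    moreover have "real (card B) \<le> ?k"
      using cardB by simp
    ultimately show ?thesis
      using cards unfolding L_def by linarith
  qed
  have dM: "?d x = real (deg E M x) + real (deg E B x)" for x
    using deg_split[OF finite_V BM(1), of E x] by (simp add: M_def)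
  have cross: "(\<Sum>x\<in>M. real (deg E B x)) = (\<Sum>b\<in>B. real (deg E M b))"
    using sum_deg_swap[OF symp_E fin(2,1)] by (metis of_nat_sum)
  have \<mu>: "\<mu> = I + (\<Sum>b\<in>B. real (deg E M b))"
    by (simp add: \<mu>_def dM sum.distrib I_def cross)
  have \<beta>: "\<beta> = (\<Sum>b\<in>B. real (deg E M b)) + (\<Sum>b\<in>B. real (deg E B b))"
    by (simp add: \<beta>_def dM sum.distrib)
  have "(\<Sum>b\<in>B. real (deg E B b)) \<le> real (card B) * ?k"
    using deg_le_card[OF fin(1), of E] cardB by (intro sum_bounded_above) (metis of_nat_mono order_trans)
  also have "\<dots> \<le> ?k\<^sup>2"
    using cardB by (simp add: power2_eq_square mult_right_mono)
  finally have \<mu>_ge: "\<mu> \<ge> I + \<beta> - ?k\<^sup>2"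
    using \<mu> \<beta> by simp
  have "\<mu> \<le> I + \<beta>"
    using \<mu> \<beta> by (simp add: sum_nonneg)
  moreover have "2 * ?n \<le> \<beta> + \<mu> + 4"
  proof -
    have "real (2 * n) \<le> real ((\<Sum>x\<in>V. deg E V x) + 4)"
      using deg_sum by (simp only: of_nat_le_iff n_def)
    then show ?thesis
      using split[of ?d] by (simp add: \<beta>_def \<mu>_def)
  qed
  ultimately have \<beta>_ge: "\<beta> \<ge> ?n - 2 - I / 2"
    by simp
  define G where "G = (\<Sum>b\<in>B. ?d b * (?n - ?d b))"
  \<comment> \<open>Triangles are dropped, and on \<open>M\<close> the count is nearly
    \<open>n / 2\<close> times the degree. Almost all edges at \<open>B\<close> end in
    \<open>M\<close>; crediting their share \<open>\<beta> * (n / 2)\<close> to \<open>B\<close>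
    turns \<open>d * (n / 2 - d)\<close> into \<open>d * (n - d)\<close>.\<close>
  have upper: "G + ?n * I / 2 \<le> 3/4 * ?n\<^sup>2 + ?n * (?k\<^sup>2 / 2) + ?n\<^sup>2 / 400"
  proof -
    have "6 * (\<Sum>x\<in>V. ?d x * (?n / 2 - ?d x)) =
        3 * ?n * (\<Sum>x\<in>V. ?d x) - 6 * (\<Sum>x\<in>V. (?d x)\<^sup>2)"
      by (simp add: algebra_simps sum_subtractf sum_distrib_left power2_eq_square)
    also have "\<dots> \<le> odd_count E V"
      using odd_count_eq[OF symp_E finite_V] tri_count_nonneg[of E V] by (simp add: n_def)
    finally have "(\<Sum>x\<in>V. ?d x * (?n / 2 - ?d x)) \<le> 3/4 * ?n\<^sup>2"
      using odd_le by (simp add: n_def)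
    moreover have "(\<Sum>x\<in>M. ?d x * (?n / 2 - ?n / 2000)) \<le> (\<Sum>x\<in>M. ?d x * (?n / 2 - ?d x))"
    proof (intro sum_mono mult_left_mono diff_left_mono)
      fix x assume "x \<in> M"
      then have "2000 * deg E V x \<le> n"
        by (auto simp: M_def B_def)
      then have "real (2000 * deg E V x) \<le> ?n"
        by (simp only: of_nat_le_iff)
      then show "?d x \<le> ?n / 2000"
        by simp
    qed simp
    moreover have "(\<Sum>x\<in>M. ?d x * (?n / 2 - ?n / 2000)) = \<mu> * (?n / 2) - \<mu> * (?n / 2000)"
      unfolding \<mu>_def sum_distrib_right[symmetric] by (rule right_diff_distrib)
    moreover have "\<mu> * (?n / 2000) \<le> 5 * ?n * (?n / 2000)"
      using tot5 nonneg by (intro mult_right_mono) auto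
    moreover have "(I + \<beta> - ?k\<^sup>2) * (?n / 2) \<le> \<mu> * (?n / 2)"
      using \<mu>_ge by (intro mult_right_mono) auto
    moreover have "(\<Sum>x\<in>B. ?d x * (?n / 2 - ?d x)) = G - \<beta> * (?n / 2)"
      unfolding G_def \<beta>_def sum_distrib_right sum_subtractf[symmetric]
      by (intro sum.cong refl) (simp add: field_simps)
    ultimately show ?thesis
      unfolding split[of "\<lambda>x. ?d x * (?n / 2 - ?d x)"] by (simp add: algebra_simps power2_eq_square)
  qed
  have err: "?n * (?k\<^sup>2 / 2) + ?n * L / 2 + 2 * ?n \<le> ?n\<^sup>2 / 1000"
  proof -
    have "?k\<^sup>2 \<ge> 0" "(2::real) ^ k \<ge> 0" "?k \<ge> 0"
      by auto
    then have "?k\<^sup>2 / 2 + L / 2 + 2 \<le> ?n / 1000"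
      using large' unfolding L_def by argo
    then have "?n * (?k\<^sup>2 / 2 + L / 2 + 2) \<le> ?n * (?n / 1000)"
      by (rule mult_left_mono) simp
    then show ?thesis
      by (simp add: algebra_simps power2_eq_square)
  qed
  have L0: "L \<ge> 0"
    by (simp add: L_def)
  have e2: "(?n - D) * (?n - 2 - I / 2) = ?n * ?n - 2 * ?n - ?n * I / 2 - ?n * D + 2 * D + D * I / 2"
    by (simp add: field_simps)
  have e3: "D * (?n - L) = ?n * D - D * L"
    by (simp add: algebra_simps)
  have e4: "?n / 2 * L = ?n * L / 2" and e9: "?n * (493/2000 * ?n) = 493/2000 * (?n * ?n)"
    and e10: "?n * (D / 2) = ?n * D / 2"
    by simp_all
  \<comment> \<open>With the lower bounds on \<open>\<beta>\<close> and \<open>I\<close>, the left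
    side of \<open>upper\<close> is at least \<open>n^2 - n * D / 2\<close> up to small errors,
    which forces \<open>D\<close> close to \<open>n / 2\<close>.\<close>
  have "(?n - D) * \<beta> \<le> G"
    unfolding G_def \<beta>_def sum_distrib_left
  proof (rule sum_mono)
    fix b assume "b \<in> B"
    then have "?d b \<le> D"
      using c_max BM by (auto simp: D_def)
    then show "(?n - D) * ?d b \<le> ?d b * (?n - ?d b)"
      by (subst mult.commute) (intro mult_left_mono, auto)
  qed
  moreover have "(?n - D) * (?n - 2 - I / 2) \<le> (?n - D) * \<beta>"
    using \<beta>_ge D_half n_pos by (intro mult_left_mono) auto
  moreover have "D * (?n - L) \<le> D * I"
    using I_ge by (intro mult_left_mono) (auto simp: D_def)
  moreover have "D * L \<le> ?n / 2 * L"
    using D_half L0 by (intro mult_right_mono) auto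
  moreover have "?n * L \<ge> 0" "D \<ge> 0"
    using L0 by (auto simp: D_def)
  ultimately have "?n * D / 2 \<ge> ?n\<^sup>2 / 4 - ?n\<^sup>2 / 400 - (?n * (?k\<^sup>2 / 2) + ?n * L / 2 + 2 * ?n)"
    using upper e2 e3 e4 unfolding power2_eq_square by linarith
  \<comment> \<open>The constant is \<open>1/4 - 1/400 - 1/1000\<close>.\<close>
  then have "?n * (D / 2) \<ge> ?n * (493/2000 * ?n)"
    using err e9 e10 unfolding power2_eq_square by linarith
  then have "493/2000 * ?n \<le> D / 2"
    using n_pos by (simp only: mult_le_cancel_left_pos)
  then have D_ge: "D \<ge> 493/1000 * ?n"
    by linarith
  have cB: "c \<in> B"
  proof -
    have "?n < real (2000 * deg E V c)"
      using D_ge n_pos by (simp add: D_def)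
    then have "n < 2000 * deg E V c"
      by (simp only: of_nat_less_iff)
    then show ?thesis
      using c by (simp add: B_def)
  qed
  have "100 * deg E V x \<le> n" if x: "x \<in> V - {c}" for x
  proof (cases "x \<in> B")
    case False
    then show ?thesis
      using x by (auto simp: B_def)
  next
    case True
    have le: "?d b \<le> ?n / 2" if "b \<in> B" for b
      using deg_less[of b] that BM by (auto simp: n_def)
    \<comment> \<open>The hub contributes almost \<open>n^2 / 4\<close> to \<open>G\<close> and
      \<open>I\<close> almost \<open>n^2 / 2\<close>, which nearly exhausts \<open>upper\<close>;
      little is left for a second vertex of \<open>B\<close>.\<close>
    have "(\<Sum>b\<in>{c, x}. ?d b * (?n - ?d b)) \<le> G"
      unfolding G_def
    proof (intro sum_mono2 mult_nonneg_nonneg)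
      fix b assume "b \<in> B - {c, x}"
      then have "?d b \<le> ?n / 2"
        using le by blast
      then show "0 \<le> ?n - ?d b"
        by linarith
    qed (use fin cB True in auto)
    then have "D * (?n - D) + ?d x * (?n - ?d x) \<le> G"
      using x by (auto simp: D_def)
    moreover have "?n * ?d x / 2 \<le> ?d x * (?n - ?d x)"
      using mult_left_mono[of "?n / 2" "?n - ?d x" "?d x"] le[OF True] by (simp add: mult.commute)
    moreover have "?n * ?n - ?n * L \<le> ?n * I"
      using mult_left_mono[OF I_ge, of ?n] by (simp add: right_diff_distrib)
    \<comment> \<open>This is \<open>0.493 * 0.507\<close>, the value at the lower end of the range
      of \<open>D / n\<close>.\<close>
    moreover have "249951/1000000 * (?n * ?n) \<le> D * (?n - D)"
    proof -
      have "0 \<le> (D - 493/1000 * ?n) * (?n - 493/1000 * ?n - D)"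
        using D_ge D_half n_pos by (intro mult_nonneg_nonneg) auto
      then show ?thesis
        by (simp add: algebra_simps)
    qed
    ultimately have "?n * ?d x / 2 \<le> ?n * ?n / 200"
      using upper err n_pos zero_le_square[of ?n] unfolding power2_eq_square by linarith
    then have "?n * (?d x / 2) \<le> ?n * (?n / 200)"
      by (simp only: times_divide_eq_right)
    then have "?d x / 2 \<le> ?n / 200"
      using n_pos by (simp only: mult_le_cancel_left_pos)
    then have "real (100 * deg E V x) \<le> ?n"
      by simp
    then show ?thesis
      by (simp only: of_nat_le_iff)
  qed
  then show ?thesis
    using that c by (auto simp: n_def)
qed

end

section \<open>The upper bound for hypercuts\<close>

lemma coboundary_cong:
  assumes "\<And>x y z. x \<noteq> y \<Longrightarrow> y \<noteq> z \<Longrightarrow> x \<noteq> z \<Longrightarrow> odd_tri E x y z \<longleftrightarrow> odd_tri F x y z"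
  shows "coboundary n E = coboundary n F"
  unfolding coboundary_def using assms by blast

lemma card_triples: "card (triples n) = n choose 3"
  by (simp add: k_subsets_def n_subsets)

lemma finite_coboundary: "finite (coboundary n E)"
  using coboundary_subset[of n E] by (rule finite_subset) (simp add: k_subsets_def)

text \<open>Complementing flips all three edges of a triple and hence its parity, so complements of
  hypercuts are again sets of odd triples.\<close>

lemma coboundary_compl:
  assumes "symp E"
  shows "coboundary n (\<lambda>x y. x \<noteq> y \<and> \<not> E x y) = triples n - coboundary n E"
proof -
  have sym: "symp (\<lambda>x y. x \<noteq> y \<and> \<not> E x y)"
    using assms by (auto simp: symp_def)
  have "\<sigma> \<in> coboundary n (\<lambda>x y. x \<noteq> y \<and> \<not> E x y) \<longleftrightarrow> \<sigma> \<notin> coboundary n E"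
    if "\<sigma> \<in> triples n" for \<sigma>
    using that
  proof (rule triplesE)
    fix x y z
    assume *: "x \<in> {1..n}" "y \<in> {1..n}" "z \<in> {1..n}" "\<sigma> = {x, y, z}" "x \<noteq> y" "y \<noteq> z" "x \<noteq> z"
    show ?thesis
      unfolding *(4) mem_coboundary_iff[OF sym *(1-3,5-7)] mem_coboundary_iff[OF assms *(1-3,5-7)]
      using *(5-7) by (auto simp: odd_tri_def)
  qed
  then show ?thesis
    using coboundary_subset by blast
qed

lemma odd_count_coboundary:
  assumes "symp E" "irreflp E"
  shows "odd_count E {1..n} = 6 * real (card (coboundary n E))"
proof -
  let ?V = "{1..n}"
  let ?f = "\<lambda>(x, y, z). {x, y, z}"
  define T where "T = {(x, y, z). x \<in> ?V \<and> y \<in> ?V \<and> z \<in> ?V \<and> odd_tri E x y z}"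
  have "T \<subseteq> ?V \<times> ?V \<times> ?V"
    by (auto simp: T_def)
  then have finT: "finite T"
    by (rule finite_subset) simp
  have dist: "x \<noteq> y \<and> y \<noteq> z \<and> x \<noteq> z" if "odd_tri E x y z" for x y z
    using that assms by (auto simp: odd_tri_def irreflp_def dest: sympD)
  have "T = (SIGMA x:?V. SIGMA y:?V. {z \<in> ?V. odd_tri E x y z})"
    by (auto simp: T_def)
  then have 1: "odd_count E ?V = real (card T)"
    by (simp add: odd_count_def card_SigmaI of_bool_def sum.If_cases Int_def)
  have im: "?f ` T = coboundary n E"
  proof
    show "?f ` T \<subseteq> coboundary n E"
      unfolding T_def coboundary_def using dist by fast
    show "coboundary n E \<subseteq> ?f ` T"
      unfolding T_def coboundary_def by force
  qed
  have fib: "card {t \<in> T. ?f t = \<sigma>} = 6" if "\<sigma> \<in> coboundary n E" for \<sigma>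
  proof -
    obtain a b c where abc: "a \<in> ?V" "b \<in> ?V" "c \<in> ?V" "\<sigma> = {a, b, c}" "a \<noteq> b" "b \<noteq> c" "a \<noteq> c"
      "odd_tri E a b c"
      using \<open>\<sigma> \<in> coboundary n E\<close> unfolding coboundary_def by blast
    have odd: "odd_tri E x y z" if "x \<in> ?V" "y \<in> ?V" "z \<in> ?V" "{x, y, z} = \<sigma>"
      "x \<noteq> y" "y \<noteq> z" "x \<noteq> z" for x y z
      using mem_coboundary_iff[OF assms(1) that(1-3,5-7)] that(4) \<open>\<sigma> \<in> coboundary n E\<close> by simp
    have "{t \<in> T. ?f t = \<sigma>} = {(a, b, c), (a, c, b), (b, a, c), (b, c, a), (c, a, b), (c, b, a)}"
      (is "?L = ?R")
    proof
      show "?L \<subseteq> ?R"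
      proof
        fix t assume t: "t \<in> ?L"
        obtain x y z where xyz: "t = (x, y, z)"
          by (cases t)
        then have "{x, y, z} = {a, b, c}" "odd_tri E x y z"
          using t abc(4) by (auto simp: T_def)
        then show "t \<in> ?R"
          using dist[of x y z] abc(5-7) unfolding xyz
          by (smt (verit) insert_iff singletonD)
      qed
      show "?R \<subseteq> ?L"
        using abc odd[of a b c] odd[of a c b] odd[of b a c] odd[of b c a] odd[of c a b] odd[of c b a]
        by (auto simp: T_def)
    qed
    also have "card \<dots> = 6"
      using abc(5-7) by (simp add: card_insert_if)
    finally show ?thesis .
  qed
  have "card T = (\<Sum>\<sigma>\<in>?f ` T. card {t \<in> T. ?f t = \<sigma>})"
    using sum.image_gen[OF finT, of "\<lambda>_. 1 :: nat" ?f] by simp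
  also have "\<dots> = 6 * card (coboundary n E)"
    unfolding im by (simp add: fib)
  finally show ?thesis
    using 1 by simp
qed

text \<open>Switching preserves the coboundary, so no switched graph has fewer edges than
  \<open>E\<close>. Both bounds compare \<open>E\<close> with a particular switching.\<close>

lemma minimal_graph_deg:
  fixes n :: nat and E :: "nat \<Rightarrow> nat \<Rightarrow> bool"
  defines "degsum \<equiv> \<lambda>G. \<Sum>x\<in>{1..n}. deg G {1..n} x"
  assumes E: "symp E" "irreflp E"
    and min: "\<And>F. symp F \<Longrightarrow> irreflp F \<Longrightarrow> coboundary n F = coboundary n E \<Longrightarrow> degsum E \<le> degsum F"
  shows "v \<in> {1..n} \<Longrightarrow> 2 * deg E {1..n} v < n"
    and "real n * (\<Sum>x\<in>{1..n}. real (deg E {1..n} x)) \<le> odd_count E {1..n}"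
proof -
  let ?V = "{1..n}"
  have sym: "E x y = E y x" for x y
    using E(1) by (metis sympD)
  show "2 * deg E ?V v < n" if v: "v \<in> ?V"
  proof -
    \<comment> \<open>Switching at \<open>v\<close> exchanges its neighbours and non-neighbours and
      leaves the edges away from \<open>v\<close> alone.\<close>
    define F where "F x y \<longleftrightarrow> (if x \<noteq> y \<and> (x = v \<or> y = v) then \<not> E x y else E x y)" for x y
    have F: "symp F" "irreflp F"
      using E sym by (auto simp: F_def symp_def irreflp_def)
    have "coboundary n F = coboundary n E"
      by (rule coboundary_cong) (auto simp: odd_tri_def F_def)
    then have "degsum E \<le> degsum F"
      using min F by blast
    moreover have "deg F (?V - {v}) x = deg E (?V - {v}) x" if "x \<noteq> v" for x
      using that unfolding deg_def F_def by (intro arg_cong[of _ _ card]) auto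
    ultimately have "deg E ?V v \<le> deg F ?V v"
      unfolding degsum_def sum_deg_remove[OF E finite_atLeastAtMost v]
        sum_deg_remove[OF F finite_atLeastAtMost v] by simp
    moreover have "deg E ?V v + deg F ?V v = card (?V - {v})"
    proof -
      have "?V - {v} = {y \<in> ?V. E v y} \<union> {y \<in> ?V. F v y}"
        using E(2) by (auto simp: F_def irreflp_def)
      moreover have "{y \<in> ?V. E v y} \<inter> {y \<in> ?V. F v y} = {}"
        using E(2) by (auto simp: F_def irreflp_def)
      ultimately show ?thesis
        by (simp add: deg_def card_Un_disjoint)
    qed
    moreover have "card (?V - {v}) < n"
      using v by (simp add: card_Diff_singleton)
    ultimately show ?thesis
      by linarith
  qed
  \<comment> \<open>The switching that isolates \<open>v\<close> has as edges the odd triples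
    through \<open>v\<close>; summing over \<open>v\<close> yields the whole count.\<close>
  have "real (degsum E) \<le> (\<Sum>x\<in>?V. \<Sum>y\<in>?V. of_bool (odd_tri E v x y))" for v
  proof -
    have "symp (odd_tri E v)" "irreflp (odd_tri E v)"
      using E sym by (auto simp: odd_tri_def symp_def irreflp_def)
    moreover have "coboundary n (odd_tri E v) = coboundary n E"
      by (rule coboundary_cong) (auto simp: odd_tri_def)
    ultimately have "degsum E \<le> degsum (odd_tri E v)"
      using min by blast
    then have "real (degsum E) \<le> real (degsum (odd_tri E v))"
      by (simp only: of_nat_le_iff)
    then show ?thesis
      by (simp add: degsum_def real_deg)
  qed
  then have "real (card ?V) * real (degsum E) \<le> odd_count E ?V"
    unfolding odd_count_def by (intro sum_bounded_below) auto
  then show "real n * (\<Sum>x\<in>?V. real (deg E ?V x)) \<le> odd_count E ?V"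
    by (simp add: degsum_def)
qed

text \<open>A largest set containing \<open>x\<close> with at least \<open>card K - 1\<close> inner
  edges is closed, since an adjacent vertex could be added. This gives the edge bound of a component
  without paths or connectivity.\<close>

lemma closed_part:
  fixes x :: nat
  assumes "symp E" "irreflp E" "finite V" "x \<in> V"
  obtains K where "K \<subseteq> V" "x \<in> K" "\<And>k y. k \<in> K \<Longrightarrow> y \<in> V - K \<Longrightarrow> \<not> E k y"
    "2 * card K \<le> (\<Sum>k\<in>K. deg E K k) + 2"
proof -
  define P where "P K \<longleftrightarrow> K \<subseteq> V \<and> x \<in> K \<and> 2 * card K \<le> (\<Sum>k\<in>K. deg E K k) + 2" for K
  have "P {x}"
    using assms(4) by (simp add: P_def)
  moreover have "\<forall>K. P K \<longrightarrow> card K \<le> card V"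
    using assms(3) by (auto simp: P_def intro: card_mono)
  ultimately obtain K where K: "P K" "\<And>K'. P K' \<Longrightarrow> card K' \<le> card K"
    using ex_has_greatest_nat[of P "{x}" card "card V + 1"] by (auto simp: less_Suc_eq_le)
  have finK: "finite K"
    using K(1) assms(3) finite_subset by (auto simp: P_def)
  have "\<not> E k y" if "k \<in> K" "y \<in> V - K" for k y
  proof
    assume "E k y"
    then have "E y k"
      using assms(1) by (rule sympD[rotated])
    then have "deg E (insert y K) y \<noteq> 0"
      using finK that(1) by (auto simp: deg_def)
    then have "1 \<le> deg E (insert y K) y"
      by simp
    moreover have "(\<Sum>k\<in>insert y K. deg E (insert y K) k) =
        2 * deg E (insert y K) y + (\<Sum>k\<in>K. deg E K k)"
      using sum_deg_remove[OF assms(1,2), of "insert y K" y] finK that(2) by simp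
    ultimately have "P (insert y K)"
      using K(1) that(2) finK by (simp add: P_def)
    then show False
      using K(2)[of "insert y K"] finK that(2) by simp
  qed
  then show ?thesis
    using that K(1) by (auto simp: P_def)
qed

lemma amgm3:
  fixes a b c :: nat
  shows "27 * (a * b * c) \<le> (a + b + c) ^ 3"
proof -
  let ?a = "real a" and ?b = "real b" and ?c = "real c"
  have "0 \<le> (?a + ?b + ?c) * ((?a - ?b)\<^sup>2 + (?b - ?c)\<^sup>2 + (?a - ?c)\<^sup>2) / 2
      + 3 * (?a * (?b - ?c)\<^sup>2 + ?b * (?a - ?c)\<^sup>2 + ?c * (?a - ?b)\<^sup>2)"
    by (intro add_nonneg_nonneg divide_nonneg_pos mult_nonneg_nonneg) auto
  also have "\<dots> = (?a + ?b + ?c) ^ 3 - 27 * (?a * ?b * ?c)"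
    by (simp add: power2_eq_square power3_eq_cube field_simps)
  finally have "real (27 * (a * b * c)) \<le> real ((a + b + c) ^ 3)"
    by simp
  then show ?thesis
    by (simp only: of_nat_le_iff)
qed

text \<open>
  The hypothesis says that the complete bipartite graph between \<open>K\<close> and \<open>L\<close> has a coboundary
  disjoint from the odd triples of \<open>E\<close>; by minimality it is then the whole hypercut, which is
  too small for that.
\<close>

lemma hypercut_no_homogeneous:
  fixes n :: nat
  assumes cut: "hypercut n C" and E: "symp E" "irreflp E" and C: "coboundary n E = triples n - C"
    and big: "n ^ 3 < 27 * card C"
    and sub: "K \<subseteq> {1..n}" "L \<subseteq> {1..n}" "K \<inter> L = {}"
    and ne: "K \<noteq> {}" "L \<noteq> {}" "{1..n} - K - L \<noteq> {}"
    and no_edge: "\<And>k l. k \<in> K \<Longrightarrow> l \<in> L \<Longrightarrow> \<not> E k l"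
    and hom: "\<And>w k l. w \<in> {1..n} - K - L \<Longrightarrow> k \<in> K \<Longrightarrow> l \<in> L \<Longrightarrow> E w k \<longleftrightarrow> E w l"
  shows False
proof -
  let ?V = "{1..n}"
  define W where "W = ?V - K - L"
  define b where "b x y \<longleftrightarrow> x \<in> K \<and> y \<in> L \<or> x \<in> L \<and> y \<in> K" for x y
  have b: "symp b"
    by (auto simp: b_def symp_def)
  have sym: "E x y = E y x" for x y
    using E(1) by (metis sympD)
  have fin: "finite K" "finite L" "finite W"
    using sub finite_subset[of _ ?V] by (auto simp: W_def)
  obtain k l w where klw: "k \<in> K" "l \<in> L" "w \<in> W"
    using ne unfolding W_def by blast
  have tripartite: "\<exists>k\<in>K. \<exists>l\<in>L. \<exists>w\<in>W. {x, y, z} = {k, l, w}"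
    if "odd_tri b x y z" "x \<in> ?V" "y \<in> ?V" "z \<in> ?V" for x y z
  proof -
    have "x \<in> K \<and> y \<in> L \<and> z \<in> W \<or> x \<in> K \<and> z \<in> L \<and> y \<in> W \<or> y \<in> K \<and> x \<in> L \<and> z \<in> W \<or>
        y \<in> K \<and> z \<in> L \<and> x \<in> W \<or> z \<in> K \<and> x \<in> L \<and> y \<in> W \<or> z \<in> K \<and> y \<in> L \<and> x \<in> W"
      using that sub(3) unfolding odd_tri_def b_def W_def by blast
    then show ?thesis
      by (elim disjE conjE) (metis insert_commute)+
  qed
  \<comment> \<open>The pair \<open>kl\<close> is not an edge and \<open>w\<close> sees
    \<open>k\<close> and \<open>l\<close> alike, so the triple has zero or two edges.\<close>
  have bK: "\<not> odd_tri E k l w" if "k \<in> K" "l \<in> L" "w \<in> W" for k l w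
    using hom[of w k l] no_edge[of k l] that sym[of k w] sym[of l w]
    unfolding odd_tri_def W_def by blast
  have tri: "k \<in> ?V" "l \<in> ?V" "w \<in> ?V" "k \<noteq> l" "l \<noteq> w" "k \<noteq> w"
    if "k \<in> K" "l \<in> L" "w \<in> W" for k l w
    using that sub by (auto simp: W_def)
  have subKLW: "coboundary n b \<subseteq> (\<lambda>(k, l, w). {k, l, w}) ` (K \<times> L \<times> W)"
  proof
    fix \<sigma> assume "\<sigma> \<in> coboundary n b"
    then obtain x y z where "x \<in> ?V" "y \<in> ?V" "z \<in> ?V" "\<sigma> = {x, y, z}" "odd_tri b x y z"
      unfolding coboundary_def by blast
    then obtain k l w where "k \<in> K" "l \<in> L" "w \<in> W" "\<sigma> = {k, l, w}"
      using tripartite[of x y z] by metis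
    then show "\<sigma> \<in> (\<lambda>(k, l, w). {k, l, w}) ` (K \<times> L \<times> W)"
      by (intro image_eqI[of _ _ "(k, l, w)"]) auto
  qed
  have "coboundary n b \<subseteq> C"
  proof
    fix \<sigma> assume \<sigma>: "\<sigma> \<in> coboundary n b"
    then obtain k l w where klw': "k \<in> K" "l \<in> L" "w \<in> W" "\<sigma> = {k, l, w}"
      using subKLW by auto
    have "\<sigma> \<notin> coboundary n E"
      unfolding klw'(4) mem_coboundary_iff[OF E(1) tri[OF klw'(1-3)]] by (rule bK[OF klw'(1-3)])
    then show "\<sigma> \<in> C"
      using C \<sigma> coboundary_subset by blast
  qed
  moreover have "odd_tri b k l w"
    using klw sub unfolding odd_tri_def b_def W_def by blast
  then have "coboundary n b \<noteq> {}"
    using mem_coboundary_iff[OF b tri[OF klw]] by blast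
  ultimately have "C = coboundary n b"
    using cut b unfolding hypercut_iff by metis
  \<comment> \<open>The product of the three part sizes is at most \<open>n^3 / 27\<close> by the
    inequality of means, contrary to \<open>big\<close>.\<close>
  then have "card C \<le> card ((\<lambda>(k, l, w). {k, l, w}) ` (K \<times> L \<times> W))"
    using subKLW fin by (intro card_mono) auto
  also have "\<dots> \<le> card (K \<times> L \<times> W)"
    using fin by (intro card_image_le) auto
  also have "\<dots> = card K * card L * card W"
    by (simp add: card_cartesian_product)
  finally have "27 * card C \<le> 27 * (card K * card L * card W)"
    by simp
  also have "\<dots> \<le> (card K + card L + card W) ^ 3"
    by (rule amgm3)
  also have "card K + card L + card W = card (K \<union> L \<union> W)"
    using fin sub(3) by (subst card_Un_disjoint; (subst card_Un_disjoint)?) (auto simp: W_def)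
  also have "K \<union> L \<union> W = ?V"
    using sub by (auto simp: W_def)
  finally show False
    using big by simp
qed

lemma choose_3_real: "real (n choose 3) = real n * (real n - 1) * (real n - 2) / 6"
  by (simp add: binomial_gbinomial gbinomial_prod_rev eval_nat_numeral atLeast0_lessThan_Suc)

text \<open>Takes a graph with fewest edges among those whose odd triples are the complement of
  \<open>C\<close>.\<close>

lemma hypercut_reduced_graph:
  assumes cut: "hypercut n C" and big: "n ^ 3 < 27 * card C" and n: "n \<ge> 3"
  obtains E where "reduced_graph {1..n} E"
    and "odd_count E {1..n} = 6 * (real (n choose 3) - real (card C))"
    and "real n * (\<Sum>x\<in>{1..n}. real (deg E {1..n} x)) \<le> odd_count E {1..n}"
proof -
  let ?V = "{1..n}"
  obtain A where A: "symp A" "C = coboundary n A"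
    using cut by (auto simp: hypercut_iff)
  define P where "P E \<longleftrightarrow> symp E \<and> irreflp E \<and> coboundary n E = triples n - C" for E
  have "P (\<lambda>x y. x \<noteq> y \<and> \<not> A x y)"
    using coboundary_compl[OF A(1)] A by (auto simp: P_def symp_def irreflp_def)
  then obtain E where E: "P E"
    and min: "\<And>F. P F \<Longrightarrow> (\<Sum>x\<in>?V. deg E ?V x) \<le> (\<Sum>x\<in>?V. deg F ?V x)"
    using ex_has_least_nat[of P _ "\<lambda>E. \<Sum>x\<in>?V. deg E ?V x"] by blast
  have sE: "symp E" "irreflp E" and cE: "coboundary n E = triples n - C"
    using E by (auto simp: P_def)
  have sym: "E x y = E y x" for x y
    using sE(1) by (metis sympD)
  have min': "(\<Sum>x\<in>?V. deg E ?V x) \<le> (\<Sum>x\<in>?V. deg F ?V x)"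
    if "symp F" "irreflp F" "coboundary n F = coboundary n E" for F
  proof (rule min)
    show "P F"
      unfolding P_def using that cE by metis
  qed
  note hom = hypercut_no_homogeneous[OF cut sE cE big]
  have deg_less: "2 * deg E ?V x < card ?V" if "x \<in> ?V" for x
    unfolding card_atLeastAtMost diff_Suc_1 using minimal_graph_deg(1)[OF sE min' that] .
  \<comment> \<open>Nonadjacent twins would be a homogeneous pair of singletons;
    \<open>n \<ge> 3\<close> supplies the third part.\<close>
  have twin_free: "\<exists>w\<in>?V. E w x \<noteq> E w y" if xy: "x \<in> ?V" "y \<in> ?V" "x \<noteq> y" "\<not> E x y" for x y
    proof (rule ccontr)
      assume neg: "\<not> ?thesis"
      have "card {x, y} < card ?V"
        using n xy(3) by simp
      then have "?V - {x} - {y} \<noteq> {}"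
        using xy by (metis Diff_insert2 Diff_eq_empty_iff card_mono finite.emptyI finite.insertI
            insert_commute not_le)
      then show False
        using hom[of "{x}" "{y}"] xy neg by auto
    qed
  \<comment> \<open>Two closed parts \<open>K\<close> and \<open>L\<close> must exhaust the
    vertices, since otherwise they form a homogeneous pair. Each loses at most one edge against its
    number of vertices.\<close>
  have deg_sum: "2 * card ?V \<le> (\<Sum>x\<in>?V. deg E ?V x) + 4"
  proof -
    have "1 \<in> ?V"
      using n by simp
    then obtain K where K: "K \<subseteq> ?V" "1 \<in> K" "\<And>k y. k \<in> K \<Longrightarrow> y \<in> ?V - K \<Longrightarrow> \<not> E k y"
      "2 * card K \<le> (\<Sum>k\<in>K. deg E K k) + 2"
      using closed_part[OF sE, of ?V 1] by auto
    have mono: "(\<Sum>k\<in>M. deg E M k) \<le> (\<Sum>k\<in>M. deg E ?V k)" if "M \<subseteq> ?V" for M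
      using that by (intro sum_mono) (auto simp: deg_def intro!: card_mono)
    show ?thesis
    proof (cases "K = ?V")
      case True
      then show ?thesis
        using K(4) by simp
    next
      case False
      then obtain x where "x \<in> ?V - K"
        using K(1) by blast
      then obtain L where L: "L \<subseteq> ?V - K" "x \<in> L" "\<And>k y. k \<in> L \<Longrightarrow> y \<in> ?V - K - L \<Longrightarrow> \<not> E k y"
        "2 * card L \<le> (\<Sum>k\<in>L. deg E L k) + 2"
        using closed_part[OF sE, of "?V - K" x] by auto
      have "?V - K - L = {}"
      proof (rule ccontr)
        assume "?V - K - L \<noteq> {}"
        moreover have "E w k \<longleftrightarrow> E w l" if "w \<in> ?V - K - L" "k \<in> K" "l \<in> L" for w k l
          using K(3)[of k w] L(3)[of l w] that sym[of w k] sym[of w l] by blast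
        moreover have "\<not> E k l" if "k \<in> K" "l \<in> L" for k l
          using K(3) L(1) that by blast
        ultimately show False
          using hom[of K L] K(1,2) L(1,2) by blast
      qed
      then have V: "?V = K \<union> L" "K \<inter> L = {}" "finite K" "finite L"
        using K(1) L(1) finite_subset[of _ ?V] by auto
      then have "card ?V = card K + card L"
        by (simp add: card_Un_disjoint)
      moreover have "(\<Sum>x\<in>?V. deg E ?V x) = (\<Sum>x\<in>K. deg E ?V x) + (\<Sum>x\<in>L. deg E ?V x)"
        using sum.union_disjoint[OF V(3,4,2)] V(1) by metis
      ultimately show ?thesis
        using K(1,4) L(1,4) mono[of K] mono[of L] by fastforce
    qed
  qed
  have "reduced_graph ?V E"
    using sE deg_less twin_free deg_sum by (intro reduced_graph.intro finite_atLeastAtMost)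
  moreover have "odd_count E ?V = 6 * (real (n choose 3) - real (card C))"
  proof -
    have "C \<subseteq> triples n"
      using A(2) coboundary_subset by blast
    moreover have "finite (triples n)"
      by (simp add: k_subsets_def)
    ultimately have "card (triples n - C) = (n choose 3) - card C" "card C \<le> n choose 3"
      using card_mono[of "triples n" C] by (auto simp: card_Diff_subset finite_subset card_triples)
    then show ?thesis
      using odd_count_coboundary[OF sE, of n] cE by (simp add: of_nat_diff)
  qed
  moreover have "real n * (\<Sum>x\<in>?V. real (deg E ?V x)) \<le> odd_count E ?V"
    by (rule minimal_graph_deg(2)[OF sE min'])
  ultimately show ?thesis
    by (rule that)
qed

lemma hypercut_card_le:
  "\<forall>\<^sub>F n in sequentially. \<forall>C. hypercut n C \<longrightarrow>
    real (card C) \<le> real (n choose 3) - shadow_bound n"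
proof -
  \<comment> \<open>Keeping \<open>k\<close> a variable leaves \<open>2 ^ k\<close>
    symbolic.\<close>
  obtain k :: nat where k: "10000 \<le> k"
    by blast
  define N where "N = 2000 * (2 + real k + (real k)\<^sup>2 + 2 ^ k)"
  have "\<forall>\<^sub>F n in sequentially. real n \<ge> N"
    using filterlim_real_sequentially unfolding filterlim_at_top by blast
  moreover have "\<forall>\<^sub>F n in sequentially. n \<ge> (100::nat)"
    by (rule eventually_ge_at_top)
  ultimately show ?thesis
  proof eventually_elim
    fix n :: nat assume N: "N \<le> real n" and n: "100 \<le> n"
    let ?n = "real n"
    have n': "?n \<ge> 100"
      using n by simp
    have bound: "shadow_bound n \<le> 3/4 * ?n\<^sup>2"
      using n' by (simp add: shadow_bound_def)
    show "\<forall>C. hypercut n C \<longrightarrow> real (card C) \<le> real (n choose 3) - shadow_bound n"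
    proof (intro allI impI, rule ccontr)
      fix C assume cut: "hypercut n C" and "\<not> real (card C) \<le> real (n choose 3) - shadow_bound n"
      then have C: "real (card C) > real (n choose 3) - shadow_bound n"
        by simp
      \<comment> \<open>A hypercut exceeding the bound has about \<open>n^3 / 6\<close> triples,
        well above \<open>n^3 / 27\<close>.\<close>
      have "?n ^ 3 < 27 * (?n * (?n - 1) * (?n - 2) / 6 - 3/4 * ?n\<^sup>2)"
      proof -
        have "0 < ?n * (7/2 * ?n * (?n - 100) + (1265/4) * ?n + 9)"
          using n' by (intro mult_pos_pos add_nonneg_pos add_nonneg_nonneg mult_nonneg_nonneg) auto
        also have "\<dots> = 27 * (?n * (?n - 1) * (?n - 2) / 6 - 3/4 * ?n\<^sup>2) - ?n ^ 3"
          by (simp add: power2_eq_square power3_eq_cube field_simps)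
        finally show ?thesis
          by simp
      qed
      then have "real (n ^ 3) < real (27 * card C)"
        using C bound by (simp add: choose_3_real)
      then have "n ^ 3 < 27 * card C"
        by (simp only: of_nat_less_iff)
      moreover have "3 \<le> n"
        using n by simp
      ultimately obtain E where E: "reduced_graph {1..n} E"
        "odd_count E {1..n} = 6 * (real (n choose 3) - real (card C))"
        "?n * (\<Sum>x\<in>{1..n}. real (deg E {1..n} x)) \<le> odd_count E {1..n}"
        using hypercut_reduced_graph[OF cut] by metis
      interpret reduced_graph "{1..n}" E
        by (rule E(1))
      have less: "odd_count E {1..n} < 6 * shadow_bound n"
        using E(2) C by simp
      then have "odd_count E {1..n} \<le> 9/2 * (real (card {1..n}))\<^sup>2"
        using bound by simp
      moreover have "(\<Sum>x\<in>{1..n}. real (deg E {1..n} x)) \<le> 5 * real (card {1..n})"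
      proof -
        \<comment> \<open>Averaging over switchings bounds the degree sum by
          \<open>9/2 * n\<close>.\<close>
        have "?n * (\<Sum>x\<in>{1..n}. real (deg E {1..n} x)) \<le> 9/2 * ?n\<^sup>2"
          using E(3) less bound by linarith
        also have "\<dots> \<le> ?n * (5 * ?n)"
          by (simp add: power2_eq_square)
        finally show ?thesis
          using n' by (simp add: mult_le_cancel_left_pos)
      qed
      moreover have "real (card {1..n}) \<ge> 2000 * (2 + real k + (real k)\<^sup>2 + 2 ^ k)"
        using N by (simp add: N_def)
      ultimately obtain c where "c \<in> {1..n}"
        "\<forall>x\<in>{1..n} - {c}. 100 * deg E {1..n} x \<le> card {1..n}"
        using hub_exists[OF k] by metis
      then have "odd_count E {1..n} \<ge> 6 * shadow_bound (card {1..n})"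
        using n by (intro odd_count_lower_bound_hub) auto
      then show False
        using less by simp
    qed
  qed
qed

section \<open>The extremal hypercut\<close>

text \<open>
  The extremal graph: vertex \<open>1\<close> is joined to all even vertices below \<open>n\<close>, each even \<open>x\<close> carries the
  pendant vertex \<open>x + 1\<close> if that is below \<open>n\<close>, and \<open>n\<close> is isolated.
\<close>

definition spider_arc :: "nat \<Rightarrow> nat \<Rightarrow> nat \<Rightarrow> bool" where
  "spider_arc n x y \<longleftrightarrow> y < n \<and> (x = 1 \<and> even y \<and> 0 < y \<or> even x \<and> 0 < x \<and> y = x + 1)"

definition spider :: "nat \<Rightarrow> nat \<Rightarrow> nat \<Rightarrow> bool" where
  "spider n x y \<longleftrightarrow> spider_arc n x y \<or> spider_arc n y x"

lemma symp_spider: "symp (spider n)"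
  by (auto simp: symp_def spider_def)

lemma spider_parity: "spider n x y \<Longrightarrow> even x \<noteq> even y"
  by (auto simp: spider_def spider_arc_def)

lemma irreflp_spider: "irreflp (spider n)"
  using spider_parity by (auto simp: irreflp_def)

lemma spider_less: "spider n x y \<Longrightarrow> x < n \<and> y < n"
  by (auto simp: spider_def spider_arc_def)

lemma spider_1_iff: "spider n 1 y \<longleftrightarrow> even y \<and> 0 < y \<and> y < n"
  by (auto simp: spider_def spider_arc_def)

lemma spider_even_iff:
  assumes "even x" "0 < x"
  shows "spider n x y \<longleftrightarrow> x < n \<and> y = 1 \<or> x + 1 < n \<and> y = x + 1"
  using assms by (auto simp: spider_def spider_arc_def)

lemma spider_odd_iff:
  assumes "odd x" "1 < x"
  shows "spider n x y \<longleftrightarrow> x < n \<and> x = y + 1"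
  using assms by (auto simp: spider_def spider_arc_def)

text \<open>Edges join vertices of opposite parity, so the graph is bipartite.\<close>

lemma tri_count_spider: "tri_count (spider n) V = 0"
proof -
  have "of_bool (spider n x y) * of_bool (spider n y z) * of_bool (spider n x z) = (0 :: real)" for x y z
    using spider_parity[of n x y] spider_parity[of n y z] spider_parity[of n x z] by auto
  then show ?thesis
    by (simp only: tri_count_def sum.neutral_const)
qed

section \<open>Degrees and odd triples of the spider\<close>

lemma deg_spider_1: "deg (spider n) {1..n} 1 = (n - 1) div 2"
proof -
  have "{y \<in> {1..n}. spider n 1 y} = (\<lambda>i. 2 * i) ` {1..(n - 1) div 2}"
    unfolding spider_1_iff by (auto elim!: evenE)
  also have "card \<dots> = (n - 1) div 2"
    by (subst card_image) (auto simp: inj_on_def)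
  finally show ?thesis
    by (simp add: deg_def)
qed

lemma deg_spider_even:
  assumes "even x" "0 < x" "x < n"
  shows "deg (spider n) {1..n} x = (if x + 1 < n then 2 else 1)"
proof -
  have "{y \<in> {1..n}. spider n x y} = (if x + 1 < n then {1, x + 1} else {1})"
    unfolding spider_even_iff[OF assms(1,2)] using assms(2,3) by auto
  then show ?thesis
    using assms(2) by (simp add: deg_def)
qed

lemma deg_spider_odd:
  assumes "odd x" "1 < x" "x < n"
  shows "deg (spider n) {1..n} x = 1"
proof -
  have "{y \<in> {1..n}. spider n x y} = {x - 1}"
    unfolding spider_odd_iff[OF assms(1,2)] using assms(2,3) by auto
  then show ?thesis
    by (simp add: deg_def)
qed

lemma deg_spider_last: "deg (spider n) {1..n} n = 0"
proof -
  have "{y \<in> {1..n}. spider n n y} = {}"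
    using spider_less by blast
  then show ?thesis
    by (simp only: deg_def card.empty)
qed

lemma sum_even_odd:
  fixes f :: "nat \<Rightarrow> real"
  assumes "1 \<le> t"
  shows "(\<Sum>x = 1..2 * t. f x) = f 1 + (\<Sum>i = 1..<t. f (2 * i) + f (2 * i + 1)) + f (2 * t)"
  using assms by (induction t rule: dec_induct) (simp_all add: numeral_2_eq_2)

lemma odd_count_spider:
  assumes "n \<ge> 4"
  shows "odd_count (spider n) {1..n} = 6 * shadow_bound n"
proof -
  let ?d = "\<lambda>x. real (deg (spider n) {1..n} x)"
  \<comment> \<open>For \<open>i < t\<close> the vertices \<open>2 * i\<close> and
    \<open>2 * i + 1\<close> form a full leg. The vertex \<open>2 * t\<close> is the isolated one
    for even \<open>n\<close> and a leg without pendant for odd \<open>n\<close>.\<close>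
  define t where "t = n div 2"
  have t: "1 \<le> t"
    using assms by (simp add: t_def)
  have inner: "?d (2 * i) = 2" "?d (2 * i + 1) = 1" if "i \<in> {1..<t}" for i
    using that deg_spider_even[of "2 * i" n] deg_spider_odd[of "2 * i + 1" n] by (auto simp: t_def)
  have cnt: "odd_count (spider n) {1..n} = 3 * real n * (\<Sum>x = 1..n. ?d x) - 6 * (\<Sum>x = 1..n. (?d x)\<^sup>2)"
    by (simp add: odd_count_eq[OF symp_spider] tri_count_spider)
  have "(\<Sum>i = 1..<t. ?d (2 * i) + ?d (2 * i + 1)) = (\<Sum>i = 1..<t. 3)"
    by (intro sum.cong refl) (subst inner, assumption, subst inner, assumption, simp)
  then have sum1: "(\<Sum>i = 1..<t. ?d (2 * i) + ?d (2 * i + 1)) = 3 * (real t - 1)"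
    using t by (simp only: sum_constant) (simp add: of_nat_diff)
  have "(\<Sum>i = 1..<t. (?d (2 * i))\<^sup>2 + (?d (2 * i + 1))\<^sup>2) = (\<Sum>i = 1..<t. 5)"
    by (intro sum.cong refl) (subst inner, assumption, subst inner, assumption, simp)
  then have sum2: "(\<Sum>i = 1..<t. (?d (2 * i))\<^sup>2 + (?d (2 * i + 1))\<^sup>2) = 5 * (real t - 1)"
    using t by (simp only: sum_constant) (simp add: of_nat_diff)
  show ?thesis
  proof (cases "even n")
    case True
    then have n: "n = 2 * t"
      by (simp add: t_def)
    have d1: "?d 1 = real t - 1"
    proof -
      have "(n - 1) div 2 + 1 = t"
        using n t by presburger
      then show ?thesis
        unfolding deg_spider_1 by (metis add_diff_cancel_right' of_nat_1 of_nat_add)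
    qed
    have dn: "?d (2 * t) = 0"
      using deg_spider_last[of n] by (simp add: n)
    have rng: "(\<Sum>x = 1..n. f x) = f 1 + (\<Sum>i = 1..<t. f (2 * i) + f (2 * i + 1)) + f (2 * t)"
      for f :: "nat \<Rightarrow> real"
      using sum_even_odd[OF t, of f] by (simp only: n)
    have S1: "(\<Sum>x = 1..n. ?d x) = 4 * (real t - 1)"
      unfolding rng sum1 d1 dn by simp
    have S2: "(\<Sum>x = 1..n. (?d x)\<^sup>2) = (real t - 1)\<^sup>2 + 5 * (real t - 1)"
      unfolding rng sum2 d1 dn by simp
    show ?thesis
      unfolding cnt S1 S2 shadow_bound_def using True by (simp add: n power2_eq_square field_simps)
  next
    case False
    then have n: "n = 2 * t + 1"
      by (simp add: t_def)
    have d1: "?d 1 = real t"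
      unfolding deg_spider_1 by (simp add: n)
    have dt: "?d (2 * t) = 1"
      using deg_spider_even[of "2 * t" n] t by (simp add: n)
    have dn: "?d (2 * t + 1) = 0"
      using deg_spider_last[of n] by (simp add: n)
    have rng: "(\<Sum>x = 1..n. f x) =
        f 1 + (\<Sum>i = 1..<t. f (2 * i) + f (2 * i + 1)) + f (2 * t) + f (2 * t + 1)"
      for f :: "nat \<Rightarrow> real"
      using sum_even_odd[OF t, of f] by (simp add: n)
    have S1: "(\<Sum>x = 1..n. ?d x) = 4 * real t - 2"
      unfolding rng sum1 d1 dt dn by simp
    have S2: "(\<Sum>x = 1..n. (?d x)\<^sup>2) = (real t)\<^sup>2 + 5 * (real t - 1) + 1"
      unfolding rng sum2 d1 dt dn by simp
    show ?thesis
      unfolding cnt S1 S2 shadow_bound_def using False by (simp add: n power2_eq_square field_simps)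
  qed
qed

text \<open>
  A coboundary disjoint from the odd triples of the spider comes from some \<open>B\<close> with \<open>n\<close> isolated;
  \<open>B\<close> then vanishes on the edges of the spider and takes the same value on any two non-edges
  \<open>xy\<close>, \<open>xz\<close> for which \<open>yz\<close> is an edge. All non-edges are linked in this way.
\<close>

lemma spider_rigid:
  assumes n: "n \<ge> 4" and B: "symp B"
    and edge: "\<And>x y. spider n x y \<Longrightarrow> x \<in> {1..n} \<Longrightarrow> y \<in> {1..n} \<Longrightarrow> \<not> B x y"
    and move: "\<And>x y z. spider n y z \<Longrightarrow> \<not> spider n x y \<Longrightarrow> \<not> spider n x z \<Longrightarrow>
      x \<in> {1..<n} \<Longrightarrow> y \<in> {1..<n} \<Longrightarrow> z \<in> {1..<n} \<Longrightarrow> x \<noteq> y \<Longrightarrow> x \<noteq> z \<Longrightarrow> B x y \<longleftrightarrow> B x z"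
    and xy: "x \<in> {1..<n}" "y \<in> {1..<n}" "x \<noteq> y"
  shows "B x y \<longleftrightarrow> B 1 3 \<and> \<not> spider n x y"
proof -
  have symB: "B x y = B y x" for x y
    using B by (metis sympD)
  have symS: "spider n x y = spider n y x" for x y
    using symp_spider by (metis sympD)
  \<comment> \<open>Moves along the edge from the hub to \<open>m\<close>.\<close>
  have leaf_mid: "B l m \<longleftrightarrow> B l 1"
    if "odd l" "1 < l" "l < n" "even m" "0 < m" "m < n" "l \<noteq> m + 1" for l m
    using that by (intro move) (auto simp: spider_odd_iff spider_even_iff)
  have step_pendant: "B x m \<longleftrightarrow> B x (m + 1)"
    if "even m" "0 < m" "m + 1 < n" "1 < x" "x < n" "x \<noteq> m" "x \<noteq> m + 1" for x m
  proof (intro move)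
    show "\<not> spider n x m" "\<not> spider n x (m + 1)"
      using that by (auto simp: symS[of x] spider_even_iff spider_odd_iff)
  qed (use that in \<open>auto simp: spider_even_iff\<close>)
  have leaf_leaf: "B l l' \<longleftrightarrow> B l 1"
    if "odd l" "1 < l" "l < n" "odd l'" "1 < l'" "l' < n" "l \<noteq> l'" for l l'
  proof -
    have m: "even (l' - 1)" "0 < l' - 1" "l' - 1 + 1 = l'"
      using that by auto
    then have "l \<noteq> l' - 1"
      using that by auto
    then show ?thesis
      using step_pendant[of "l' - 1" l] leaf_mid[of l "l' - 1"] that m by auto
  qed
  \<comment> \<open>The leaf 3 exists because \<open>n \<ge> 4\<close>, so the non-edge from 1 to 3
    serves as reference.\<close>
  have leaf_hub: "B l 1 \<longleftrightarrow> B 1 3" if "odd l" "1 < l" "l < n" for l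
    using leaf_leaf[of l 3] leaf_leaf[of 3 l] symB that n by (cases "l = 3") auto
  have mid_mid': "B m m' \<longleftrightarrow> B 1 3"
    if "even m" "0 < m" "m < n" "even m'" "0 < m'" "m' + 1 < n" "m \<noteq> m'" for m m'
  proof -
    have "B m m' \<longleftrightarrow> B m (m' + 1)"
      using that by (intro step_pendant) auto
    also have "\<dots> \<longleftrightarrow> B (m' + 1) 1"
      using leaf_mid[of "m' + 1" m] symB that by auto
    finally show ?thesis
      using leaf_hub[of "m' + 1"] that by auto
  qed
  \<comment> \<open>At most one even vertex lacks a pendant, so by symmetry the move can use the leg
    of the other.\<close>
  have mid_mid: "B m m' \<longleftrightarrow> B 1 3"
    if "even m" "0 < m" "m < n" "even m'" "0 < m'" "m' < n" "m \<noteq> m'" for m m'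
  proof (cases "m' + 1 < n")
    case True
    then show ?thesis
      using mid_mid' that by blast
  next
    case False
    then have "m + 1 < n"
      using that by presburger
    then show ?thesis
      using mid_mid'[of m' m] that symB by blast
  qed
  have main: "B x y \<longleftrightarrow> B 1 3"
    if "\<not> spider n x y" "x \<in> {1..<n}" "y \<in> {1..<n}" "x \<noteq> y" for x y
  proof -
    have kind: "x = 1 \<or> even x \<and> 0 < x \<or> odd x \<and> 1 < x" "y = 1 \<or> even y \<and> 0 < y \<or> odd y \<and> 1 < y"
      using that by auto
    have nb: "\<not> spider n x y" "\<not> spider n y x"
      using that(1) symS by blast+
    have lt: "x < n" "y < n" "x \<noteq> y"
      using that by auto
    \<comment> \<open>The hub is adjacent to every even vertex below \<open>n\<close>, so those
      pairs do not occur.\<close>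
    consider "x = 1" "odd y \<and> 1 < y" | "y = 1" "odd x \<and> 1 < x"
      | "even x \<and> 0 < x" "even y \<and> 0 < y" | "even x \<and> 0 < x" "odd y \<and> 1 < y"
      | "odd x \<and> 1 < x" "even y \<and> 0 < y" | "odd x \<and> 1 < x" "odd y \<and> 1 < y"
      using kind nb lt by (auto simp: spider_1_iff simp del: One_nat_def)
    then show ?thesis
    proof cases
      case 1
      then show ?thesis
        using leaf_hub symB lt by blast
    next
      case 2
      then show ?thesis
        using leaf_hub lt by blast
    next
      case 3
      then show ?thesis
        using mid_mid lt that(4) by blast
    next
      case 4
      then have "y \<noteq> x + 1"
        using that(1) lt spider_even_iff by blast
      then show ?thesis
        using 4 leaf_mid leaf_hub symB lt by blast
    next
      case 5
      then have "x \<noteq> y + 1"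
        using that(1) lt spider_odd_iff by blast
      then show ?thesis
        using 5 leaf_mid leaf_hub lt by blast
    next
      case 6
      then show ?thesis
        using leaf_leaf leaf_hub lt that(4) by blast
    qed
  qed
  show ?thesis
    using main[OF _ xy] edge[of x y] xy by fastforce
qed

text \<open>Both the complement of the spider and any competing graph are switched so that
  \<open>n\<close> is isolated; rigidity then leaves only the empty graph and \<open>A\<close> on
  \<open>{1..n}\<close>.\<close>

lemma hypercut_spider:
  assumes "n \<ge> 4"
  shows "hypercut n (triples n - coboundary n (spider n))"
  unfolding hypercut_iff
proof (intro conjI allI impI)
  let ?V = "{1..n}" and ?C = "triples n - coboundary n (spider n)"
  \<comment> \<open>The complement joins \<open>n\<close> to all other vertices, and switching at
    \<open>n\<close> isolates it.\<close>
  define A where "A x y \<longleftrightarrow> x \<noteq> n \<and> y \<noteq> n \<and> x \<noteq> y \<and> \<not> spider n x y" for x y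
  have A: "symp A"
    using symp_spider by (auto simp: A_def symp_def)
  have "\<not> spider n n y" "\<not> spider n y n" for y
    using spider_less by blast+
  then have CA: "coboundary n A = ?C"
    unfolding coboundary_compl[OF symp_spider, symmetric]
    by (intro coboundary_cong) (auto simp: A_def odd_tri_def)
  show "\<exists>E. symp E \<and> ?C = coboundary n E"
    using A CA by blast
  have "\<not> odd_tri (spider n) 1 3 n"
    using spider_parity[of n 1 3] spider_less by (auto simp: odd_tri_def)
  then have "{1, 3, n} \<notin> coboundary n (spider n)"
    using mem_coboundary_iff[OF symp_spider, of 1 n 3 n n] assms by auto
  moreover have "{1, 3, n} \<in> triples n"
    using assms by (intro triplesI) auto
  ultimately show "?C \<noteq> {}"
    by blast
  fix B' assume B': "symp B'" "coboundary n B' \<noteq> {}" "coboundary n B' \<subseteq> ?C"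
  \<comment> \<open>The explicit conditions keep \<open>n\<close> isolated even if \<open>B'\<close>
    has a loop there.\<close>
  define B where "B x y \<longleftrightarrow> x \<noteq> n \<and> y \<noteq> n \<and> odd_tri B' n x y" for x y
  have symB': "B' x y = B' y x" for x y
    using B'(1) by (metis sympD)
  have B: "symp B"
    using symB' by (auto simp: B_def symp_def odd_tri_def)
  have BB': "coboundary n B = coboundary n B'"
    using symB' by (intro coboundary_cong) (auto simp: B_def odd_tri_def)
  have even_B: "\<not> odd_tri B x y z"
    if "odd_tri (spider n) x y z" "x \<in> ?V" "y \<in> ?V" "z \<in> ?V" "x \<noteq> y" "y \<noteq> z" "x \<noteq> z" for x y z
    using mem_coboundary_iff[OF B that(2-)] mem_coboundary_iff[OF symp_spider that(2-)] that(1) B'(3) BB'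
    by blast
  have edge: "\<not> B x y" if "spider n x y" "x \<in> ?V" "y \<in> ?V" for x y
  proof -
    have lt: "x < n" "y < n" "x \<noteq> y"
      using that spider_less spider_parity by blast+
    have "odd_tri (spider n) n x y"
      using that(1) spider_less by (auto simp: odd_tri_def)
    then have "\<not> odd_tri B n x y"
      using even_B[of n x y] that lt by auto
    then show ?thesis
      by (auto simp: odd_tri_def B_def)
  qed
  have move: "B x y \<longleftrightarrow> B x z"
    if "spider n y z" "\<not> spider n x y" "\<not> spider n x z" "x \<in> {1..<n}" "y \<in> {1..<n}" "z \<in> {1..<n}"
      "x \<noteq> y" "x \<noteq> z" for x y z
  proof -
    have "y \<noteq> z"
      using that(1) spider_parity by blast
    moreover have "odd_tri (spider n) x y z"
      using that(1-3) by (auto simp: odd_tri_def)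
    ultimately have "\<not> odd_tri B x y z"
      using even_B[of x y z] that(4-) by auto
    moreover have "\<not> B y z"
      using edge[of y z] that by auto
    ultimately show ?thesis
      by (auto simp: odd_tri_def)
  qed
  have Bn: "\<not> B x n" "\<not> B n x" for x
    by (simp_all add: B_def)
  have rigid: "B x y \<longleftrightarrow> B 1 3 \<and> A x y" if xy: "x \<in> ?V" "y \<in> ?V" "x \<noteq> y" for x y
  proof (cases "x = n \<or> y = n")
    case True
    then show ?thesis
      using Bn by (auto simp: A_def)
  next
    case False
    then show ?thesis
      using spider_rigid[OF assms B edge move, of x y] xy by (auto simp: A_def)
  qed
  \<comment> \<open>The value at the reference pair decides between the empty coboundary, excluded
    by assumption, and that of \<open>A\<close>.\<close>
  have "coboundary n B = {\<sigma> \<in> coboundary n A. B 1 3}"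
  proof -
    have "odd_tri B x y z \<longleftrightarrow> B 1 3 \<and> odd_tri A x y z"
      if "x \<in> ?V" "y \<in> ?V" "z \<in> ?V" "x \<noteq> y" "y \<noteq> z" "x \<noteq> z" for x y z
      unfolding odd_tri_def using rigid[of x y] rigid[of y z] rigid[of x z] that by blast
    then show ?thesis
      unfolding coboundary_def by blast
  qed
  then show "coboundary n B' = ?C"
    using B'(2) BB' CA by auto
qed

theorem theorem3:
  "\<forall>\<^sub>F n in sequentially.
     \<exists>C. hypercut n C \<and> (\<forall>D. hypercut n D \<longrightarrow> card D \<le> card C) \<and>
         real (card C) = real (n choose 3) -
           (if even n then 3/4 * real n ^ 2 - 7/2 * real n + 4
            else 3/4 * real n ^ 2 - 4 * real n + 25/4)"
  using hypercut_card_le eventually_ge_at_top[of 4]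
proof eventually_elim
  fix n :: nat
  assume le: "\<forall>C. hypercut n C \<longrightarrow> real (card C) \<le> real (n choose 3) - shadow_bound n" and n: "4 \<le> n"
  let ?S = "coboundary n (spider n)"
  have "real (card (triples n - ?S)) = real (n choose 3) - real (card ?S)"
    using coboundary_subset[of n "spider n"] card_mono[of "triples n" ?S]
    by (simp add: card_Diff_subset finite_coboundary card_triples k_subsets_def of_nat_diff
        flip: card_triples)
  also have "real (card ?S) = shadow_bound n"
    using odd_count_coboundary[OF symp_spider irreflp_spider, of n n] odd_count_spider[OF n] by simp
  finally have card: "real (card (triples n - ?S)) = real (n choose 3) - shadow_bound n" .
  show "\<exists>C. hypercut n C \<and> (\<forall>D. hypercut n D \<longrightarrow> card D \<le> card C) \<and>
         real (card C) = real (n choose 3) -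
           (if even n then 3/4 * real n ^ 2 - 7/2 * real n + 4
            else 3/4 * real n ^ 2 - 4 * real n + 25/4)"
  proof (intro exI conjI allI impI)
    show "hypercut n (triples n - ?S)"
      using n by (rule hypercut_spider)
    show "card D \<le> card (triples n - ?S)" if "hypercut n D" for D
    proof -
      have "real (card D) \<le> real (card (triples n - ?S))"
        unfolding card using le that by blast
      then show ?thesis
        by (simp only: of_nat_le_iff)
    qed
  qed (use card in \<open>simp only: shadow_bound_def\<close>)
qed

end
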